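(* Let $\mathcal Q(C_a,C_b)$ be an HGP code of length $n$ (taken from a sequence of HGP codes satisfying the scaling assumptions in the context, and with logical Pauli operators given by SLT bases). For every logical qubit $(i,h,L)$ of the left sector there exists a Clifford circuit $\mathsf C$ with support size $\chi(\mathsf C)=\Theta(\sqrt n)$ and depth $\delta(\mathsf C)=\Theta(\sqrt n)$ that implements the single-qubit targeted logical Hadamard gate $\overline H_{i,h,L}$.
   Context: All vectors are row vectors over $\mathbb F_2$; $e_i$ denotes a standard basis vector. Given binary matrices $H_a$ ($m_a\times n_a$), $H_b$ ($m_b\times n_b$), parity-check matrices of classical codes $C_a=\ker H_a$, $C_b=\ker H_b$, the hypergraph product (HGP) code $\mathcal Q(C_a,C_b)$ is the CSS code on $n=n_an_b+m_am_b$ qubits with $$H_X=[H_a\otimes I_{n_b}\,|\,I_{m_a}\otimes H_b^{\top}],\qquad H_Z=[I_{n_a}\otimes H_b\,|\,H_a^{\top}\otimes I_{m_b}].$$ Its stabilizer generators are the $X$-type Pauli operators supported on the rows of $H_X$ and the $Z$-type Pauli operators supported on the rows of $H_Z$. The first $n_an_b$ qubits form the left sector and the remaining ones the right sector. An SLT basis of a subspace is a basis $\{a_i\}$ indexed by distinct coordinates $i$ (pivots) such that $(a_i)_i=1$ and $(a_{i'})_i=0$ for pivots $i'\ne i$. Let $\{a_i\},\{\alpha_j\},\{b_h\},\{\beta_l\}$ be SLT bases of $\ker H_a,\ker H_a^{\top},\ker H_b,\ker H_b^{\top}$. Logical qubits are labelled $(i,h,L)$ ($i,h$ pivots of $\{a_i\},\{b_h\}$)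 and $(j,l,R)$ ($j,l$ pivots of $\{\alpha_j\},\{\beta_l\}$). Logical Paulis: $\overline X_{i,h,L}$ is the $X$-type operator with support vector $[e_i\otimes b_h|0]$, $\overline Z_{i,h,L}$ the $Z$-type operator with $[a_i\otimes e_h|0]$, $\overline X_{j,l,R}$ the $X$-type operator with $[0|\alpha_j\otimes e_l]$, $\overline Z_{j,l,R}$ the $Z$-type operator with $[0|e_j\otimes\beta_l]$. Scaling assumptions: a sequence of HGP codes with $n\to\infty$, where $n_a,n_b$ scale in proportion to $\sqrt n$ and the dimensions and distances of the constituent codes are a constant proportion of their lengths, so that the Hamming weights of all vectors in the four SLT bases are $\Theta(\sqrt n)$ (uniformly). A Clifford circuit $\mathsf C$ is a finite sequence of one- and two-qubit gates on the $n$ physical qubits from $\{H,S,CNOT,CZ,SWAP\}$ and single-qubit Paulis (no ancillas), enacting a unitary $U$. Its support is the smallest set of qubits such that $U$ acts as the identity on every qubit outside it, with size $\chi(\mathsf C)$; its depth $\delta(\mathsf C)$ is the minimum number of layers into which its gates can be arranged so that gates in the same layer do not overlap on qubits. $\mathsf C$ implements a logical gate $g$ if $USU^\dagger=S$ for every stabilizer generator $S$ and conjugation by $U$ acts on the logical Paulis as $g$ prescribes, up to global phases of logical Paulis. $\overline H_{i,h,L}$ exchanges $\overline X_{i,h,L}$ and $\overline Z_{i,h,L}$ and fixes all other logical Paulis $\overline X,\overline Z$. *)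

theory Defs
  imports
    Complex_Main
    "HOL-Library.Z2"
    "HOL-Library.Landau_Symbols"
    "Jordan_Normal_Form.Matrix_Kernel"
    "Jordan_Normal_Form.Schur_Decomposition"
begin

section \<open>Binary linear algebra\<close>

text \<open>The field with two elements is the type \<^typ>\<open>bit\<close>; the code with parity-check matrix
  \<open>A\<close> is \<open>mat_kernel A\<close>, its dimension \<open>kernel_dim A\<close>, its length \<open>dim_col A\<close>.\<close>

definition mat_tensor :: "'a::semiring_1 mat \<Rightarrow> 'a mat \<Rightarrow> 'a mat" (infixl "\<otimes>\<^sub>m" 70) where
  "A \<otimes>\<^sub>m B = mat (dim_row A * dim_row B) (dim_col A * dim_col B)
     (\<lambda>(r, c). A $$ (r div dim_row B, c div dim_col B) * B $$ (r mod dim_row B, c mod dim_col B))"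

definition vec_tensor :: "'a::semiring_1 vec \<Rightarrow> 'a vec \<Rightarrow> 'a vec" (infixl "\<otimes>\<^sub>v" 70) where
  "u \<otimes>\<^sub>v v = vec (dim_vec u * dim_vec v) (\<lambda>p. u $ (p div dim_vec v) * v $ (p mod dim_vec v))"

definition append_cols :: "'a::zero mat \<Rightarrow> 'a mat \<Rightarrow> 'a mat" (infixr "@\<^sub>c" 65) where
  "A @\<^sub>c B = four_block_mat A B (0\<^sub>m 0 (dim_col A)) (0\<^sub>m 0 (dim_col B))"

definition hamming_weight :: "bit vec \<Rightarrow> nat" where
  "hamming_weight v = card {p. p < dim_vec v \<and> v $ p = 1}"

text \<open>Minimum weight of a nonzero codeword (by convention \<open>0\<close> for the zero code).\<close>
definition code_distance :: "bit mat \<Rightarrow> nat" where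
  "code_distance A = Inf (hamming_weight ` (mat_kernel A - {0\<^sub>v (dim_col A)}))"

text \<open>A family of vectors indexed by a set of pivot coordinates; the values of \<open>slt_vec\<close> off
  \<open>pivots\<close> are irrelevant.\<close>
record slt_family =
  pivots :: "nat set"
  slt_vec :: "nat \<Rightarrow> bit vec"

definition is_slt_basis :: "bit mat \<Rightarrow> slt_family \<Rightarrow> bool" where
  "is_slt_basis A B \<longleftrightarrow>
     pivots B \<subseteq> {..<dim_col A} \<and>
     (\<forall>i\<in>pivots B. slt_vec B i $ i = 1) \<and>
     (\<forall>i\<in>pivots B. \<forall>i'\<in>pivots B. i' \<noteq> i \<longrightarrow> slt_vec B i' $ i = 0) \<and>
     kernel.basis (dim_col A) A (slt_vec B ` pivots B)"


section \<open>Hypergraph product codes with SLT bases\<close>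

record hgp =
  Ha :: "bit mat"
  Hb :: "bit mat"
  slt_a :: slt_family      \<comment> \<open>for the kernel of \<open>Ha\<close>\<close>
  slt_\<alpha> :: slt_family      \<comment> \<open>for the kernel of the transpose of \<open>Ha\<close>\<close>
  slt_b :: slt_family      \<comment> \<open>for the kernel of \<open>Hb\<close>\<close>
  slt_\<beta> :: slt_family      \<comment> \<open>for the kernel of the transpose of \<open>Hb\<close>\<close>

abbreviation na :: "hgp \<Rightarrow> nat" where "na Q \<equiv> dim_col (Ha Q)"
abbreviation ma :: "hgp \<Rightarrow> nat" where "ma Q \<equiv> dim_row (Ha Q)"
abbreviation nb :: "hgp \<Rightarrow> nat" where "nb Q \<equiv> dim_col (Hb Q)"
abbreviation mb :: "hgp \<Rightarrow> nat" where "mb Q \<equiv> dim_row (Hb Q)"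

definition has_slt_bases :: "hgp \<Rightarrow> bool" where
  "has_slt_bases Q \<longleftrightarrow>
     is_slt_basis (Ha Q) (slt_a Q) \<and> is_slt_basis (transpose_mat (Ha Q)) (slt_\<alpha> Q) \<and>
     is_slt_basis (Hb Q) (slt_b Q) \<and> is_slt_basis (transpose_mat (Hb Q)) (slt_\<beta> Q)"

definition code_length :: "hgp \<Rightarrow> nat" where
  "code_length Q = na Q * nb Q + ma Q * mb Q"

definition HX :: "hgp \<Rightarrow> bit mat" where
  "HX Q = (Ha Q \<otimes>\<^sub>m 1\<^sub>m (nb Q)) @\<^sub>c (1\<^sub>m (ma Q) \<otimes>\<^sub>m transpose_mat (Hb Q))"

definition HZ :: "hgp \<Rightarrow> bit mat" where
  "HZ Q = (1\<^sub>m (na Q) \<otimes>\<^sub>m Hb Q) @\<^sub>c (transpose_mat (Ha Q) \<otimes>\<^sub>m 1\<^sub>m (mb Q))"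


section \<open>Operators on qubits\<close>

text \<open>An operator on \<open>n\<close> qubits is a complex matrix of dimension \<open>2 ^ n\<close>. The computational basis
  state of index \<open>r < 2 ^ n\<close> assigns to qubit \<open>p\<close> the binary digit \<open>bit r p\<close>.\<close>

definition mat_H :: "complex mat" where
  "mat_H = mat_of_rows_list 2 [[1 / sqrt 2, 1 / sqrt 2], [1 / sqrt 2, - 1 / sqrt 2]]"
definition mat_S :: "complex mat" where
  "mat_S = mat_of_rows_list 2 [[1, 0], [0, \<i>]]"
definition mat_X :: "complex mat" where
  "mat_X = mat_of_rows_list 2 [[0, 1], [1, 0]]"
definition mat_Y :: "complex mat" where
  "mat_Y = mat_of_rows_list 2 [[0, - \<i>], [\<i>, 0]]"
definition mat_Z :: "complex mat" where
  "mat_Z = mat_of_rows_list 2 [[1, 0], [0, - 1]]"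
definition mat_CNOT :: "complex mat" where
  "mat_CNOT = mat_of_rows_list 4 [[1, 0, 0, 0], [0, 1, 0, 0], [0, 0, 0, 1], [0, 0, 1, 0]]"
definition mat_CZ :: "complex mat" where
  "mat_CZ = mat_of_rows_list 4 [[1, 0, 0, 0], [0, 1, 0, 0], [0, 0, 1, 0], [0, 0, 0, - 1]]"
definition mat_SWAP :: "complex mat" where
  "mat_SWAP = mat_of_rows_list 4 [[1, 0, 0, 0], [0, 0, 1, 0], [0, 1, 0, 0], [0, 0, 0, 1]]"

text \<open>The tensor product over all qubits \<open>p\<close> of \<open>M\<close> raised to the power \<open>v $ p\<close>.\<close>
definition pauli_op :: "complex mat \<Rightarrow> bit vec \<Rightarrow> complex mat" where
  "pauli_op M v = mat (2 ^ dim_vec v) (2 ^ dim_vec v)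
     (\<lambda>(r, c). \<Prod>p<dim_vec v.
        (if v $ p = 1 then M else 1\<^sub>m 2) $$ (of_bool (bit r p), of_bool (bit c p)))"

text \<open>The value of the binary string which \<open>r\<close> assigns to the listed qubits, the first of them
  being the most significant (so \<open>[control, target]\<close> matches \<^const>\<open>mat_CNOT\<close>).\<close>
definition sub_index :: "nat list \<Rightarrow> nat \<Rightarrow> nat" where
  "sub_index qs r = horner_sum of_bool 2 (map (bit r) (rev qs))"

text \<open>\<open>G\<close> acting on the listed qubits, tensored with the identity on all other qubits.\<close>
definition apply_on :: "nat \<Rightarrow> nat list \<Rightarrow> complex mat \<Rightarrow> complex mat" where
  "apply_on n qs G = mat (2 ^ n) (2 ^ n)
     (\<lambda>(r, c). if \<forall>p<n. p \<notin> set qs \<longrightarrow> bit r p = bit c p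
               then G $$ (sub_index qs r, sub_index qs c) else 0)"

text \<open>\<open>U\<close> acts as the identity on qubit \<open>q\<close>: it is the tensor product of the identity on \<open>q\<close> and
  some operator \<open>V\<close> on the remaining qubits, whose basis states are represented by the indices
  with binary digit \<open>q\<close> cleared.\<close>
definition acts_as_identity_on :: "nat \<Rightarrow> complex mat \<Rightarrow> nat \<Rightarrow> bool" where
  "acts_as_identity_on n U q \<longleftrightarrow>
     (\<exists>V. \<forall>r<2 ^ n. \<forall>c<2 ^ n.
        U $$ (r, c) = of_bool (bit r q = bit c q) * V (unset_bit q r) (unset_bit q c))"


section \<open>Clifford circuits\<close>

datatype gate = Gate_H nat | Gate_S nat | Gate_X nat | Gate_Y nat | Gate_Z nat
  | Gate_CNOT nat nat | Gate_CZ nat nat | Gate_SWAP nat nat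

fun gate_qubits :: "gate \<Rightarrow> nat list" where
  "gate_qubits (Gate_H q) = [q]"
| "gate_qubits (Gate_S q) = [q]"
| "gate_qubits (Gate_X q) = [q]"
| "gate_qubits (Gate_Y q) = [q]"
| "gate_qubits (Gate_Z q) = [q]"
| "gate_qubits (Gate_CNOT p q) = [p, q]"
| "gate_qubits (Gate_CZ p q) = [p, q]"
| "gate_qubits (Gate_SWAP p q) = [p, q]"

fun gate_mat :: "gate \<Rightarrow> complex mat" where
  "gate_mat (Gate_H _) = mat_H"
| "gate_mat (Gate_S _) = mat_S"
| "gate_mat (Gate_X _) = mat_X"
| "gate_mat (Gate_Y _) = mat_Y"
| "gate_mat (Gate_Z _) = mat_Z"
| "gate_mat (Gate_CNOT _ _) = mat_CNOT"
| "gate_mat (Gate_CZ _ _) = mat_CZ"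
| "gate_mat (Gate_SWAP _ _) = mat_SWAP"

definition is_circuit :: "nat \<Rightarrow> gate list \<Rightarrow> bool" where
  "is_circuit n C \<longleftrightarrow> (\<forall>g\<in>set C. distinct (gate_qubits g) \<and> set (gate_qubits g) \<subseteq> {..<n})"

text \<open>The gates are applied in the order of the list, so the head is the rightmost factor.\<close>
fun circuit_op :: "nat \<Rightarrow> gate list \<Rightarrow> complex mat" where
  "circuit_op n [] = 1\<^sub>m (2 ^ n)"
| "circuit_op n (g # C) = circuit_op n C * apply_on n (gate_qubits g) (gate_mat g)"

definition circuit_support :: "nat \<Rightarrow> gate list \<Rightarrow> nat set" where
  "circuit_support n C =
     (LEAST A. A \<subseteq> {..<n} \<and> (\<forall>q\<in>{..<n} - A. acts_as_identity_on n (circuit_op n C) q))"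

definition support_size :: "nat \<Rightarrow> gate list \<Rightarrow> nat" where
  "support_size n C = card (circuit_support n C)"

definition overlap :: "gate \<Rightarrow> gate \<Rightarrow> bool" where
  "overlap g g' \<longleftrightarrow> set (gate_qubits g) \<inter> set (gate_qubits g') \<noteq> {}"

text \<open>Gates that overlap lie in different layers and keep their order in the circuit, so that the
  layered arrangement is the same circuit.\<close>
definition circuit_depth :: "gate list \<Rightarrow> nat" where
  "circuit_depth C =
     (LEAST d. \<exists>layer :: nat \<Rightarrow> nat.
        (\<forall>s<length C. layer s < d) \<and>
        (\<forall>t<length C. \<forall>s<t. overlap (C ! s) (C ! t) \<longrightarrow> layer s < layer t))"


section \<open>Logical Pauli operators and logical gates\<close>

datatype logical_qubit = Left nat nat | Right nat nat

datatype logical_pauli = LX logical_qubit | LZ logical_qubit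

definition logical_qubits :: "hgp \<Rightarrow> logical_qubit set" where
  "logical_qubits Q =
     {Left i h | i h. i \<in> pivots (slt_a Q) \<and> h \<in> pivots (slt_b Q)} \<union>
     {Right j l | j l. j \<in> pivots (slt_\<alpha> Q) \<and> l \<in> pivots (slt_\<beta> Q)}"

definition left_vec :: "hgp \<Rightarrow> bit vec \<Rightarrow> bit vec" where
  "left_vec Q v = v @\<^sub>v 0\<^sub>v (ma Q * mb Q)"

definition right_vec :: "hgp \<Rightarrow> bit vec \<Rightarrow> bit vec" where
  "right_vec Q v = 0\<^sub>v (na Q * nb Q) @\<^sub>v v"

fun logical_op :: "hgp \<Rightarrow> logical_pauli \<Rightarrow> complex mat" where
  "logical_op Q (LX (Left i h)) =
     pauli_op mat_X (left_vec Q (unit_vec (na Q) i \<otimes>\<^sub>v slt_vec (slt_b Q) h))"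
| "logical_op Q (LZ (Left i h)) =
     pauli_op mat_Z (left_vec Q (slt_vec (slt_a Q) i \<otimes>\<^sub>v unit_vec (nb Q) h))"
| "logical_op Q (LX (Right j l)) =
     pauli_op mat_X (right_vec Q (slt_vec (slt_\<alpha> Q) j \<otimes>\<^sub>v unit_vec (mb Q) l))"
| "logical_op Q (LZ (Right j l)) =
     pauli_op mat_Z (right_vec Q (unit_vec (ma Q) j \<otimes>\<^sub>v slt_vec (slt_\<beta> Q) l))"

definition stabilizer_generators :: "hgp \<Rightarrow> complex mat set" where
  "stabilizer_generators Q =
     pauli_op mat_X ` set (rows (HX Q)) \<union> pauli_op mat_Z ` set (rows (HZ Q))"

text \<open>A logical gate is given by its action on the logical Pauli operators, here for gates that map
  each of them to another one. Stabilizer generators must be fixed exactly, logical Pauli operators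
  only up to a global phase.\<close>
definition implements :: "hgp \<Rightarrow> gate list \<Rightarrow> (logical_pauli \<Rightarrow> logical_pauli) \<Rightarrow> bool" where
  "implements Q C g \<longleftrightarrow>
     (let U = circuit_op (code_length Q) C in
        (\<forall>S\<in>stabilizer_generators Q. U * S * mat_adjoint U = S) \<and>
        (\<forall>P\<in>LX ` logical_qubits Q \<union> LZ ` logical_qubits Q.
           \<exists>\<phi>. cmod \<phi> = 1 \<and> U * logical_op Q P * mat_adjoint U = \<phi> \<cdot>\<^sub>m logical_op Q (g P)))"

definition logical_hadamard :: "logical_qubit \<Rightarrow> logical_pauli \<Rightarrow> logical_pauli" where
  "logical_hadamard q P = (if P = LX q then LZ q else if P = LZ q then LX q else P)"


section \<open>Uniform asymptotics\<close>

text \<open>\<open>f k x = \<Theta>(g k)\<close> as \<open>k\<close> tends to infinity, with constants that do not depend on \<open>x \<in> I k\<close>.\<close>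
definition uniform_bigtheta ::
  "(nat \<Rightarrow> 'i set) \<Rightarrow> (nat \<Rightarrow> 'i \<Rightarrow> real) \<Rightarrow> (nat \<Rightarrow> real) \<Rightarrow> bool" where
  "uniform_bigtheta I f g \<longleftrightarrow>
     (\<exists>c1>0. \<exists>c2>0. \<forall>\<^sub>F k in sequentially. \<forall>x\<in>I k. c1 * g k \<le> f k x \<and> f k x \<le> c2 * g k)"

text \<open>The Hamming weights of the vectors of a sequence of SLT bases grow as \<open>g\<close>.\<close>
definition slt_weights_bigtheta :: "(nat \<Rightarrow> slt_family) \<Rightarrow> (nat \<Rightarrow> real) \<Rightarrow> bool" where
  "slt_weights_bigtheta B g \<longleftrightarrow>
     uniform_bigtheta (\<lambda>k. pivots (B k)) (\<lambda>k i. real (hamming_weight (slt_vec (B k) i))) g"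

end

theory Submission
  imports Defs
begin

text \<open>
  The supports of \<open>\<X>\<close>, the logical $X$ operator of the qubit, and of its logical $Z$ operator \<open>\<Z>\<close>
  meet in the single qubit \<open>q = (i, h)\<close>. CNOT gates from \<open>q\<close> onto the rest of the support
  of \<open>\<X>\<close> and from the rest of the support of \<open>\<Z>\<close> onto \<open>q\<close> shrink the two operators to
  $X$ and $Z$ on \<open>q\<close>. A Hadamard gate on \<open>q\<close> conjugated by these gates is therefore the operator
  \<open>U = (\<X> + \<Z>) / sqrt 2\<close>. As \<open>\<X>\<close> and \<open>\<Z>\<close> are anticommuting involutions, \<open>U\<close> is an
  involution exchanging them, and it commutes with everything that commutes with both, in
  particular with the stabilizers and the other logical Pauli operators. All gates act on \<open>q\<close>, so the
  depth is the number of gates, which is linear in the weights of the two operators.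
\<close>

section \<open>Matrix entries and commutation of Pauli operators\<close>

text \<open>Sums and products of bits stay field operations, so that scalar products can be treated
  by ring lemmas.\<close>

declare add_bit_eq_xor [simp del] mult_bit_eq_and [simp del]

section \<open>Binary digits of basis state indices\<close>

lemma nat_eq_of_bits:
  assumes "r < 2 ^ n" "c < 2 ^ n" "\<And>p. p < n \<Longrightarrow> bit r p = bit c p"
  shows "r = (c :: nat)"
proof -
  have "take_bit n r = take_bit n c"
    using assms(3) by (intro bit_eqI) (auto simp: bit_take_bit_iff)
  with assms(1,2) show ?thesis
    by (metis take_bit_nat_eq_self_iff)
qed

lemma less_exp_if_bits:
  assumes "\<And>p. bit (r :: nat) p \<Longrightarrow> p < n"
  shows "r < 2 ^ n"
proof -
  have "take_bit n r = r"
    using assms by (intro bit_eqI) (auto simp: bit_take_bit_iff)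
  then show ?thesis
    by (simp add: take_bit_nat_eq_self_iff)
qed

lemma bit_less_exp: "r < 2 ^ n \<Longrightarrow> bit (r :: nat) p \<Longrightarrow> p < n"
  by (metis bit_take_bit_iff take_bit_nat_eq_self_iff)

lemma unset_bit_less_exp: "r < 2 ^ n \<Longrightarrow> unset_bit q (r :: nat) < 2 ^ n"
  by (rule less_exp_if_bits) (auto simp: bit_unset_bit_iff dest: bit_less_exp)

section \<open>Permutation matrices given by maps of indices\<close>

definition index_map_mat :: "nat \<Rightarrow> (nat \<Rightarrow> nat) \<Rightarrow> complex mat" where
  "index_map_mat N f = mat N N (\<lambda>(r, c). of_bool (r = f c))"

lemma index_map_mat_carrier [simp]: "index_map_mat N f \<in> carrier_mat N N"
  by (simp add: index_map_mat_def)

text \<open>Column \<open>c\<close> has its one in row \<open>f c\<close>, so a factor on the left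
  requires inverting \<open>f\<close>. As \<open>f\<close> is an involution, \<open>r = f i\<close>
  means \<open>i = f r\<close>, and a single summand survives.\<close>

lemma index_map_mat_mult_left:
  assumes M: "M \<in> carrier_mat N N"
    and f: "\<And>r. r < N \<Longrightarrow> f r < N" "\<And>r. r < N \<Longrightarrow> f (f r) = r"
    and "r < N" "c < N"
  shows "(index_map_mat N f * M) $$ (r, c) = M $$ (f r, c)"
proof -
  have "(index_map_mat N f * M) $$ (r, c) = (\<Sum>i = 0..<N. of_bool (r = f i) * M $$ (i, c))"
    using assms by (simp add: index_map_mat_def scalar_prod_def)
  also have "\<dots> = (\<Sum>i = 0..<N. if i = f r then M $$ (i, c) else 0)"
    using f \<open>r < N\<close> by (intro sum.cong) auto
  also have "\<dots> = M $$ (f r, c)"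
    using f \<open>r < N\<close> by simp
  finally show ?thesis .
qed

lemma index_map_mat_mult_right:
  assumes M: "M \<in> carrier_mat N N"
    and f: "\<And>r. r < N \<Longrightarrow> f r < N"
    and "r < N" "c < N"
  shows "(M * index_map_mat N f) $$ (r, c) = M $$ (r, f c)"
proof -
  have "(M * index_map_mat N f) $$ (r, c) = (\<Sum>i = 0..<N. M $$ (r, i) * of_bool (i = f c))"
    using assms by (simp add: index_map_mat_def scalar_prod_def)
  also have "\<dots> = (\<Sum>i = 0..<N. if i = f c then M $$ (r, i) else 0)"
    by (intro sum.cong) auto
  also have "\<dots> = M $$ (r, f c)"
    using f \<open>c < N\<close> by simp
  finally show ?thesis .
qed

section \<open>Entries of Pauli operators\<close>

lemma prod_of_bool:
  assumes "finite A"
  shows "(\<Prod>p\<in>A. of_bool (P p)) = (of_bool (\<forall>p\<in>A. P p) :: complex)"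
  using assms by induction auto

text \<open>The nontrivial additive character of the field with two elements; it turns scalar
  products of bit vectors into the phases of $Z$-type operators.\<close>

definition bsign :: "bit \<Rightarrow> complex" where
  "bsign b = (if b = 1 then - 1 else 1)"

lemma bsign_simps [simp]: "bsign 0 = 1" "bsign 1 = - 1"
  by (simp_all add: bsign_def)

lemma bsign_add: "bsign (a + b) = bsign a * bsign b"
  by (cases a; cases b) (simp_all add: bsign_def)

lemma bsign_sum: "finite A \<Longrightarrow> bsign (sum f A) = (\<Prod>p\<in>A. bsign (f p))"
  by (induction rule: finite_induct) (simp_all add: bsign_add)

definition bits :: "nat \<Rightarrow> nat \<Rightarrow> bit vec" where
  "bits n r = vec n (\<lambda>p. of_bool (bit r p))"

lemma bits_carrier [simp]: "bits n r \<in> carrier_vec n"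
  and dim_bits [simp]: "dim_vec (bits n r) = n"
  by (simp_all add: bits_def)

lemma bits_index [simp]: "p < n \<Longrightarrow> bits n r $ p = of_bool (bit r p)"
  by (simp add: bits_def)

lemma pauli_op_carrier: "v \<in> carrier_vec n \<Longrightarrow> pauli_op M v \<in> carrier_mat (2 ^ n) (2 ^ n)"
  by (auto simp: pauli_op_def)

lemma pauli_op_dim: "v \<in> carrier_vec n \<Longrightarrow> dim_row (pauli_op M v) = 2 ^ n"
  "v \<in> carrier_vec n \<Longrightarrow> dim_col (pauli_op M v) = 2 ^ n"
  by (auto simp: pauli_op_def)

lemma mat_X_index:
  "a < 2 \<Longrightarrow> b < 2 \<Longrightarrow> mat_X $$ (a, b) = of_bool (a \<noteq> b)"
  by (auto simp: mat_X_def mat_of_rows_list_def less_2_cases_iff)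

lemma mat_Z_index:
  "a < 2 \<Longrightarrow> b < 2 \<Longrightarrow> mat_Z $$ (a, b) = of_bool (a = b) * (if a = 1 then - 1 else 1)"
  by (auto simp: mat_Z_def mat_of_rows_list_def less_2_cases_iff)

lemma pauli_X_index:
  assumes "v \<in> carrier_vec n" "r < 2 ^ n" "c < 2 ^ n"
  shows "pauli_op mat_X v $$ (r, c) = of_bool (\<forall>p<n. bit r p \<noteq> bit c p \<longleftrightarrow> v $ p = 1)"
proof -
  have "pauli_op mat_X v $$ (r, c) =
      (\<Prod>p<n. of_bool (bit r p \<noteq> bit c p \<longleftrightarrow> v $ p = 1))"
    using assms by (auto simp: pauli_op_def mat_X_index intro!: prod.cong)
  then show ?thesis
    by (simp add: prod_of_bool Ball_def)
qed

text \<open>Each tensor factor is diagonal. The product therefore splits into a condition that all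
  digits agree, that is \<open>r = c\<close>, and a product of signs, which is the character of a
  sum.\<close>

lemma pauli_Z_index:
  assumes "v \<in> carrier_vec n" "r < 2 ^ n" "c < 2 ^ n"
  shows "pauli_op mat_Z v $$ (r, c) = of_bool (r = c) * bsign (v \<bullet> bits n r)"
proof -
  have "(if v $ p = 1 then mat_Z else 1\<^sub>m 2) $$ (of_bool (bit r p), of_bool (bit c p)) =
      of_bool (bit r p = bit c p) * bsign (v $ p * bits n r $ p)" if "p < n" for p
    using that by (auto simp: mat_Z_index bsign_def)
  then have "pauli_op mat_Z v $$ (r, c) =
      (\<Prod>p<n. of_bool (bit r p = bit c p) * bsign (v $ p * bits n r $ p))"
    unfolding pauli_op_def using assms by (simp cong: prod.cong_simp del: of_bool_eq_iff)
  also have "\<dots> = (\<Prod>p<n. of_bool (bit r p = bit c p)) * (\<Prod>p<n. bsign (v $ p * bits n r $ p))"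
    by (rule prod.distrib)
  also have "(\<Prod>p<n. bsign (v $ p * bits n r $ p)) = bsign (v \<bullet> bits n r)"
    by (simp only: scalar_prod_def dim_bits bsign_sum lessThan_atLeast0 finite_atLeastLessThan)
  also have "(\<Prod>p<n. of_bool (bit r p = bit c p)) = (of_bool (\<forall>p<n. bit r p = bit c p) :: complex)"
    by (simp add: prod_of_bool Ball_def)
  also have "(\<forall>p<n. bit r p = bit c p) \<longleftrightarrow> r = c"
    using assms nat_eq_of_bits by blast
  finally show ?thesis .
qed

text \<open>Translation by \<open>v\<close> on basis states: the Horner sum is the number whose
  binary digits are the entries of \<open>v\<close>. Digits beyond the length of \<open>v\<close>
  are left alone.\<close>

definition flip :: "bit vec \<Rightarrow> nat \<Rightarrow> nat" where
  "flip v r = Bit_Operations.xor r (horner_sum of_bool 2 (map (\<lambda>p. v $ p = 1) [0..<dim_vec v]))"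

lemma bit_flip: "v \<in> carrier_vec n \<Longrightarrow>
    bit (flip v r) p \<longleftrightarrow> (if p < n \<and> v $ p = 1 then \<not> bit r p else bit r p)"
  by (auto simp: flip_def bit_simps)

lemma flip_less:
  assumes "v \<in> carrier_vec n" "r < 2 ^ n"
  shows "flip v r < 2 ^ n"
  using assms by (intro less_exp_if_bits) (auto simp: bit_flip split: if_splits dest: bit_less_exp)

lemma flip_flip: "v \<in> carrier_vec n \<Longrightarrow> flip v (flip v r) = r"
  by (rule bit_eqI) (auto simp: bit_flip)

lemma bits_flip: "v \<in> carrier_vec n \<Longrightarrow> bits n (flip v r) = bits n r + v"
  by (rule eq_vecI) (auto simp: bit_flip)

text \<open>Both matrices have entries 0 and 1, and \<open>r = flip v c\<close> says that
  \<open>r\<close> and \<open>c\<close> differ exactly on the support of \<open>v\<close>. Products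
  with $X$-type operators thus become shifts of indices.\<close>

lemma pauli_X_eq_index_map_mat:
  assumes v: "v \<in> carrier_vec n"
  shows "pauli_op mat_X v = index_map_mat (2 ^ n) (flip v)"
proof (rule eq_matI)
  fix r c assume "r < dim_row (index_map_mat (2 ^ n) (flip v))"
    "c < dim_col (index_map_mat (2 ^ n) (flip v))"
  then have rc: "r < 2 ^ n" "c < 2 ^ n"
    by (simp_all add: index_map_mat_def)
  have "r = flip v c \<longleftrightarrow> (\<forall>p<n. bit r p \<noteq> bit c p \<longleftrightarrow> v $ p = 1)"
  proof
    assume "\<forall>p<n. bit r p \<noteq> bit c p \<longleftrightarrow> v $ p = 1"
    then show "r = flip v c"
      using v by (intro nat_eq_of_bits[OF rc(1) flip_less[OF v rc(2)]]) (auto simp: bit_flip)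
  next
    assume r: "r = flip v c"
    show "\<forall>p<n. bit r p \<noteq> bit c p \<longleftrightarrow> v $ p = 1"
      unfolding r using v by (simp add: bit_flip)
  qed
  then show "pauli_op mat_X v $$ (r, c) = index_map_mat (2 ^ n) (flip v) $$ (r, c)"
    using v rc by (simp add: pauli_X_index index_map_mat_def)
qed (use v in \<open>simp_all add: pauli_op_dim index_map_mat_def\<close>)

section \<open>Squares and commutation of Pauli operators\<close>

lemma pauli_Z_mult_left:
  assumes v: "v \<in> carrier_vec n" and M: "M \<in> carrier_mat (2 ^ n) (2 ^ n)"
    and rc: "r < 2 ^ n" "c < 2 ^ n"
  shows "(pauli_op mat_Z v * M) $$ (r, c) = bsign (v \<bullet> bits n r) * M $$ (r, c)"
proof -
  have "(pauli_op mat_Z v * M) $$ (r, c) =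
      (\<Sum>i = 0..<2 ^ n. pauli_op mat_Z v $$ (r, i) * M $$ (i, c))"
    using assms pauli_op_carrier[OF v] by (simp add: scalar_prod_def pauli_op_dim)
  also have "\<dots> = (\<Sum>i = 0..<2 ^ n. if i = r then bsign (v \<bullet> bits n r) * M $$ (r, c) else 0)"
    using v rc by (intro sum.cong) (auto simp: pauli_Z_index)
  finally show ?thesis
    using rc by simp
qed

lemma pauli_Z_mult_right:
  assumes v: "v \<in> carrier_vec n" and M: "M \<in> carrier_mat (2 ^ n) (2 ^ n)"
    and rc: "r < 2 ^ n" "c < 2 ^ n"
  shows "(M * pauli_op mat_Z v) $$ (r, c) = bsign (v \<bullet> bits n c) * M $$ (r, c)"
proof -
  have "(M * pauli_op mat_Z v) $$ (r, c) =
      (\<Sum>i = 0..<2 ^ n. M $$ (r, i) * pauli_op mat_Z v $$ (i, c))"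
    using assms pauli_op_carrier[OF v] by (simp add: scalar_prod_def pauli_op_dim)
  also have "\<dots> = (\<Sum>i = 0..<2 ^ n. if i = c then bsign (v \<bullet> bits n c) * M $$ (r, c) else 0)"
    using v rc by (intro sum.cong) (auto simp: pauli_Z_index)
  finally show ?thesis
    using rc by simp
qed

lemma bsign_mult_self [simp]: "bsign b * bsign b = 1" "bsign b * (bsign b * z) = z"
  by (auto simp: bsign_def)

lemma pauli_X_square:
  assumes v: "v \<in> carrier_vec n"
  shows "pauli_op mat_X v * pauli_op mat_X v = 1\<^sub>m (2 ^ n)"
proof (rule eq_matI)
  fix r c assume "r < dim_row (1\<^sub>m (2 ^ n) :: complex mat)" "c < dim_col (1\<^sub>m (2 ^ n) :: complex mat)"
  then have rc: "r < 2 ^ n" "c < 2 ^ n" by simp_all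
  have "(pauli_op mat_X v * pauli_op mat_X v) $$ (r, c) = index_map_mat (2 ^ n) (flip v) $$ (flip v r, c)"
    using v rc unfolding pauli_X_eq_index_map_mat[OF v]
    by (intro index_map_mat_mult_left) (auto simp: flip_less flip_flip)
  also have "\<dots> = of_bool (flip v r = flip v c)"
    using v rc by (simp add: index_map_mat_def flip_less)
  also have "flip v r = flip v c \<longleftrightarrow> r = c"
    using v by (metis flip_flip)
  finally show "(pauli_op mat_X v * pauli_op mat_X v) $$ (r, c) = 1\<^sub>m (2 ^ n) $$ (r, c)"
    using rc by simp
qed (use v in \<open>simp_all add: pauli_op_dim\<close>)

lemma pauli_Z_square:
  assumes v: "v \<in> carrier_vec n"
  shows "pauli_op mat_Z v * pauli_op mat_Z v = 1\<^sub>m (2 ^ n)"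
  using v by (intro eq_matI)
    (auto simp: pauli_Z_mult_left pauli_op_carrier pauli_op_dim pauli_Z_index simp del: index_mult_mat(1))

text \<open>The entry of either product tests whether \<open>r\<close> and \<open>c\<close> differ
  by the sum of \<open>u\<close> and \<open>v\<close>, a condition symmetric in the two
  vectors.\<close>

lemma pauli_X_commute:
  assumes u: "u \<in> carrier_vec n" and v: "v \<in> carrier_vec n"
  shows "pauli_op mat_X u * pauli_op mat_X v = pauli_op mat_X v * pauli_op mat_X u"
proof (rule eq_matI)
  fix r c assume "r < dim_row (pauli_op mat_X v * pauli_op mat_X u)"
    "c < dim_col (pauli_op mat_X v * pauli_op mat_X u)"
  then have rc: "r < 2 ^ n" "c < 2 ^ n" 
    using u v by (simp_all add: pauli_op_dim)
  have "(pauli_op mat_X u * pauli_op mat_X v) $$ (r, c) = of_bool (flip u r = flip v c)"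
    using u v rc unfolding pauli_X_eq_index_map_mat[OF u]
    by (subst index_map_mat_mult_left)
       (auto simp: flip_less flip_flip pauli_op_carrier pauli_X_eq_index_map_mat[OF v] index_map_mat_def)
  moreover have "(pauli_op mat_X v * pauli_op mat_X u) $$ (r, c) = of_bool (flip v r = flip u c)"
    using u v rc unfolding pauli_X_eq_index_map_mat[OF v]
    by (subst index_map_mat_mult_left)
       (auto simp: flip_less flip_flip pauli_op_carrier pauli_X_eq_index_map_mat[OF u] index_map_mat_def)
  moreover have "flip u r = flip v c \<longleftrightarrow> flip v r = flip u c"
    unfolding bit_eq_iff using u v by (auto simp: bit_flip split: if_splits)
  ultimately show "(pauli_op mat_X u * pauli_op mat_X v) $$ (r, c) =
      (pauli_op mat_X v * pauli_op mat_X u) $$ (r, c)" by simp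
qed (use u v in \<open>simp_all add: pauli_op_dim\<close>)

lemma pauli_Z_commute:
  assumes u: "u \<in> carrier_vec n" and v: "v \<in> carrier_vec n"
  shows "pauli_op mat_Z u * pauli_op mat_Z v = pauli_op mat_Z v * pauli_op mat_Z u"
  using u v by (intro eq_matI)
    (auto simp: pauli_Z_mult_left pauli_op_carrier pauli_op_dim pauli_Z_index simp del: index_mult_mat(1))

text \<open>The $X$ operator moves state \<open>c\<close> to \<open>c\<close> shifted by
  \<open>u\<close>, which changes the exponent of the $Z$ phase by the scalar product of
  \<open>v\<close> and \<open>u\<close>. Commutation is thereby reduced to linear algebra over the
  field with two elements.\<close>

lemma pauli_X_Z_commutation:
  assumes u: "u \<in> carrier_vec n" and v: "v \<in> carrier_vec n"
  shows "pauli_op mat_X u * pauli_op mat_Z v =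
    bsign (u \<bullet> v) \<cdot>\<^sub>m (pauli_op mat_Z v * pauli_op mat_X u)"
proof (rule eq_matI)
  fix r c assume "r < dim_row (bsign (u \<bullet> v) \<cdot>\<^sub>m (pauli_op mat_Z v * pauli_op mat_X u))"
    "c < dim_col (bsign (u \<bullet> v) \<cdot>\<^sub>m (pauli_op mat_Z v * pauli_op mat_X u))"
  then have rc: "r < 2 ^ n" "c < 2 ^ n"
    using u v by (simp_all add: pauli_op_dim)
  have "(pauli_op mat_X u * pauli_op mat_Z v) $$ (r, c) =
      bsign (v \<bullet> bits n c) * of_bool (r = flip u c)"
    using u v rc
    by (simp add: pauli_Z_mult_right pauli_op_carrier pauli_X_eq_index_map_mat index_map_mat_def)
  also have "\<dots> = bsign (u \<bullet> v) * (bsign (v \<bullet> bits n r) * of_bool (r = flip u c))"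
  proof -
    have "v \<bullet> bits n (flip u c) = v \<bullet> bits n c + v \<bullet> u"
      using u v by (simp add: bits_flip scalar_prod_add_distrib[of _ n])
    moreover have "v \<bullet> u = u \<bullet> v"
      by (rule comm_scalar_prod[OF v u])
    ultimately show ?thesis
      by (simp add: bsign_add)
  qed
  also have "\<dots> = (bsign (u \<bullet> v) \<cdot>\<^sub>m (pauli_op mat_Z v * pauli_op mat_X u)) $$ (r, c)"
    using u v rc pauli_Z_mult_left[OF v pauli_op_carrier[OF u], of r c mat_X]
    by (simp add: pauli_X_eq_index_map_mat index_map_mat_def pauli_op_dim del: index_mult_mat(1))
  finally show "(pauli_op mat_X u * pauli_op mat_Z v) $$ (r, c) =
      (bsign (u \<bullet> v) \<cdot>\<^sub>m (pauli_op mat_Z v * pauli_op mat_X u)) $$ (r, c)" .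
qed (use u v in \<open>simp_all add: pauli_op_dim\<close>)

section \<open>Conjugation by CNOT gates and the Hadamard circuit\<close>

definition cnot :: "nat \<Rightarrow> nat \<Rightarrow> nat \<Rightarrow> nat" where
  "cnot s t c = (if bit c s then flip_bit t c else c)"

lemma bit_cnot: "s \<noteq> t \<Longrightarrow> bit (cnot s t c) p \<longleftrightarrow> (if p = t then bit c t \<noteq> bit c s else bit c p)"
  by (auto simp: cnot_def bit_flip_bit_iff)

lemma cnot_less: "s \<noteq> t \<Longrightarrow> t < n \<Longrightarrow> c < 2 ^ n \<Longrightarrow> cnot s t c < 2 ^ n"
  by (rule less_exp_if_bits) (auto simp: bit_cnot split: if_splits dest: bit_less_exp)

lemma cnot_cnot: "s \<noteq> t \<Longrightarrow> cnot s t (cnot s t c) = c"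
  by (rule bit_eqI) (auto simp: bit_cnot)

lemma all_less_split: "s < n \<Longrightarrow> t < (n :: nat) \<Longrightarrow>
    (\<forall>p<n. P p) \<longleftrightarrow> P s \<and> P t \<and> (\<forall>p<n. p \<noteq> s \<and> p \<noteq> t \<longrightarrow> P p)"
  by blast

lemma apply_on_CNOT:
  assumes st: "s < n" "t < n" "s \<noteq> t"
  shows "apply_on n [s, t] mat_CNOT = index_map_mat (2 ^ n) (cnot s t)"
proof (rule eq_matI)
  fix r c assume "r < dim_row (index_map_mat (2 ^ n) (cnot s t))"
    "c < dim_col (index_map_mat (2 ^ n) (cnot s t))"
  then have rc: "r < 2 ^ n" "c < 2 ^ n"
    by (simp_all add: index_map_mat_def)
  \<comment> \<open>Sixteen cases: the control and target digits of row and column.\<close>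
  have entry: "mat_CNOT $$ (sub_index [s, t] r, sub_index [s, t] c) =
      of_bool (bit r s = bit c s \<and> bit r t = (bit c t \<noteq> bit c s))"
    by (cases "bit r s"; cases "bit r t"; cases "bit c s"; cases "bit c t")
       (simp_all add: sub_index_def mat_CNOT_def mat_of_rows_list_def numeral_eq_Suc)
  have "r = cnot s t c \<longleftrightarrow> (\<forall>p<n. bit r p = bit (cnot s t c) p)"
    using nat_eq_of_bits[OF rc(1) cnot_less[OF st(3,2) rc(2)]] by blast
  also have "\<dots> \<longleftrightarrow> (\<forall>p<n. p \<notin> set [s, t] \<longrightarrow> bit r p = bit c p) \<and>
      (bit r s = bit c s \<and> bit r t = (bit c t \<noteq> bit c s))"
    using st by (subst all_less_split[OF st(1,2)]) (auto simp: bit_cnot)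
  finally show "apply_on n [s, t] mat_CNOT $$ (r, c) = index_map_mat (2 ^ n) (cnot s t) $$ (r, c)"
    using rc entry by (simp add: apply_on_def index_map_mat_def)
qed (simp_all add: apply_on_def index_map_mat_def)

lemma apply_on_carrier: "apply_on n qs G \<in> carrier_mat (2 ^ n) (2 ^ n)"
  by (simp add: apply_on_def)

section \<open>The normalised sum of an X-type and a Z-type operator\<close>

definition pauli_sum :: "bit vec \<Rightarrow> bit vec \<Rightarrow> complex mat" where
  "pauli_sum x z = complex_of_real (1 / sqrt 2) \<cdot>\<^sub>m (pauli_op mat_X x + pauli_op mat_Z z)"

lemma pauli_sum_carrier: "x \<in> carrier_vec n \<Longrightarrow> z \<in> carrier_vec n \<Longrightarrow>
    pauli_sum x z \<in> carrier_mat (2 ^ n) (2 ^ n)"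
  by (simp add: pauli_sum_def pauli_op_carrier)

lemma pauli_sum_index:
  assumes "x \<in> carrier_vec n" "z \<in> carrier_vec n" "r < 2 ^ n" "c < 2 ^ n"
  shows "pauli_sum x z $$ (r, c) = complex_of_real (1 / sqrt 2) *
    (of_bool (\<forall>p<n. bit r p \<noteq> bit c p \<longleftrightarrow> x $ p = 1) + of_bool (r = c) * bsign (z \<bullet> bits n r))"
  using assms pauli_op_carrier[of x n mat_X] pauli_op_carrier[of z n mat_Z]
  by (simp add: pauli_sum_def pauli_op_dim pauli_X_index pauli_Z_index)

text \<open>The Hadamard matrix is $(X + Z) / sqrt 2$: $X$ supplies the off-diagonal entries and $Z$
  the diagonal ones. This is the innermost layer of the circuit.\<close>

lemma apply_on_H:
  assumes q: "q < n"
  shows "apply_on n [q] mat_H = pauli_sum (unit_vec n q) (unit_vec n q)"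
proof (rule eq_matI)
  let ?P = "pauli_sum (unit_vec n q :: bit vec) (unit_vec n q)"
  note carr = pauli_sum_carrier[of "unit_vec n q" n "unit_vec n q"]
  fix r c assume "r < dim_row ?P" "c < dim_col ?P"
  then have rc: "r < 2 ^ n" "c < 2 ^ n"
    using carr by auto
  let ?same = "\<forall>p<n. p \<notin> set [q] \<longrightarrow> bit r p = bit c p"
  have entry: "mat_H $$ (sub_index [q] r, sub_index [q] c) =
      complex_of_real (1 / sqrt 2) * (if bit r q \<and> bit c q then - 1 else 1)"
    by (cases "bit r q"; cases "bit c q")
       (simp_all add: sub_index_def mat_H_def mat_of_rows_list_def numeral_eq_Suc)
  have eq: "r = c \<longleftrightarrow> ?same \<and> bit r q = bit c q"
    using nat_eq_of_bits[OF rc] q by auto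
  have flipped: "(\<forall>p<n. bit r p \<noteq> bit c p \<longleftrightarrow> (unit_vec n q :: bit vec) $ p = 1) \<longleftrightarrow>
      ?same \<and> bit r q \<noteq> bit c q"
    using q by auto
  have "(unit_vec n q :: bit vec) \<bullet> bits n r = of_bool (bit r q)"
    using q by (simp add: scalar_prod_left_unit[of _ n])
  then show "apply_on n [q] mat_H $$ (r, c) = ?P $$ (r, c)"
    using rc unfolding pauli_sum_index[OF unit_vec_carrier unit_vec_carrier rc] eq flipped
    by (auto simp: apply_on_def entry)
qed (use pauli_sum_carrier[of "unit_vec n q" n "unit_vec n q"] in \<open>auto simp: apply_on_def\<close>)

lemma index_map_mat_conj:
  assumes M: "M \<in> carrier_mat N N"
    and f: "\<And>r. r < N \<Longrightarrow> f r < N" "\<And>r. r < N \<Longrightarrow> f (f r) = r"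
    and rc: "r < N" "c < N"
  shows "(index_map_mat N f * M * index_map_mat N f) $$ (r, c) = M $$ (f r, f c)"
proof -
  have "index_map_mat N f * M \<in> carrier_mat N N"
    using M by (intro mult_carrier_mat) auto
  then show ?thesis
    by (subst index_map_mat_mult_right)
       (use assms in \<open>auto simp: index_map_mat_mult_left simp del: index_mult_mat(1)\<close>)
qed

text \<open>A CNOT gate propagates $X$ from control to target and $Z$ from target to control,
  without any phase. Conjugation relabels both indices by \<open>cnot\<close>, so the two supports
  change by a linear map and its transpose.\<close>

lemma CNOT_conj_pauli_sum:
  assumes st: "s < n" "t < n" "s \<noteq> t" and x: "x \<in> carrier_vec n" and z: "z \<in> carrier_vec n"
  shows "apply_on n [s, t] mat_CNOT * pauli_sum x z * apply_on n [s, t] mat_CNOT =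
    pauli_sum (x + x $ s \<cdot>\<^sub>v unit_vec n t) (z + z $ t \<cdot>\<^sub>v unit_vec n s)"
    (is "?L = pauli_sum ?x ?z")
proof (rule eq_matI)
  have xz: "?x \<in> carrier_vec n" "?z \<in> carrier_vec n"
    using x z by auto
  note carr = pauli_sum_carrier[OF xz] apply_on_carrier[of n "[s, t]" mat_CNOT]
  fix r c assume "r < dim_row (pauli_sum ?x ?z)" "c < dim_col (pauli_sum ?x ?z)"
  then have rc: "r < 2 ^ n" "c < 2 ^ n"
    using carr by auto
  then have less: "cnot s t r < 2 ^ n" "cnot s t c < 2 ^ n"
    using cnot_less st by auto
  \<comment> \<open>The difference pattern of the two indices changes only at \<open>t\<close>,
    where the difference at \<open>s\<close> is added.\<close>
  have "(\<forall>p<n. bit (cnot s t r) p \<noteq> bit (cnot s t c) p \<longleftrightarrow> x $ p = 1) \<longleftrightarrow>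
      (\<forall>p<n. bit r p \<noteq> bit c p \<longleftrightarrow> ?x $ p = 1)"
    unfolding all_less_split[OF st(1,2), of "\<lambda>p. bit (cnot s t r) p \<noteq> bit (cnot s t c) p \<longleftrightarrow> x $ p = 1"]
      all_less_split[OF st(1,2), of "\<lambda>p. bit r p \<noteq> bit c p \<longleftrightarrow> ?x $ p = 1"]
    using st x
    by (cases "x $ s"; cases "x $ t") (auto simp: bit_cnot)
  moreover have "z \<bullet> bits n (cnot s t r) = ?z \<bullet> bits n r"
  proof -
    \<comment> \<open>On digit vectors \<open>cnot\<close> is linear; moving it to the other side of
      the scalar product yields its transpose acting on \<open>z\<close>.\<close>
    have "bits n (cnot s t r) = bits n r + bits n r $ s \<cdot>\<^sub>v unit_vec n t"
      using st by (intro eq_vecI) (auto simp: bit_cnot)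
    then have "z \<bullet> bits n (cnot s t r) = z \<bullet> bits n r + bits n r $ s * z $ t"
      using st z by (simp add: scalar_prod_add_distrib[of _ n] scalar_prod_right_unit[of _ n] del: bits_index)
    also have "\<dots> = ?z \<bullet> bits n r"
      using st z by (simp add: add_scalar_prod_distrib[of _ n] scalar_prod_left_unit[of _ n] mult.commute
        del: bits_index)
    finally show ?thesis .
  qed
  moreover have "cnot s t r = cnot s t c \<longleftrightarrow> r = c"
    using st by (metis cnot_cnot)
  ultimately have "pauli_sum x z $$ (cnot s t r, cnot s t c) = pauli_sum ?x ?z $$ (r, c)"
    unfolding pauli_sum_index[OF x z less] pauli_sum_index[OF xz rc] by simp
  moreover have "?L $$ (r, c) = pauli_sum x z $$ (cnot s t r, cnot s t c)"
    unfolding apply_on_CNOT[OF st]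
    by (rule index_map_mat_conj) (use x z st rc in \<open>auto simp: pauli_sum_carrier cnot_less cnot_cnot\<close>)
  ultimately show "?L $$ (r, c) = pauli_sum ?x ?z $$ (r, c)"
    by simp
qed (use x z pauli_sum_carrier[of ?x n ?z] in \<open>auto simp: apply_on_def\<close>)

section \<open>The operator of the Hadamard circuit\<close>

lemma circuit_op_carrier: "circuit_op n C \<in> carrier_mat (2 ^ n) (2 ^ n)"
  by (induction C) (auto intro!: mult_carrier_mat[where n = "2 ^ n"] apply_on_carrier)

lemma circuit_op_append: "circuit_op n (C @ D) = circuit_op n D * circuit_op n C"
proof (induction C)
  case Nil
  then show ?case using right_mult_one_mat[OF circuit_op_carrier[of n D]] by simp
next
  case (Cons g C)
  then show ?case
    using assoc_mult_mat[OF circuit_op_carrier circuit_op_carrier apply_on_carrier] by simp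
qed

lemma circuit_op_conj:
  "circuit_op n (g # C @ [g]) =
    apply_on n (gate_qubits g) (gate_mat g) * circuit_op n C * apply_on n (gate_qubits g) (gate_mat g)"
  using left_mult_one_mat[OF apply_on_carrier[of n "gate_qubits g" "gate_mat g"]]
  by (simp add: circuit_op_append)

text \<open>The list is a palindrome around \<open>Gate_H q\<close>. As CNOT gates are involutions,
  it is a nest of conjugations, peeled off one at a time by the two equations that follow.\<close>

definition hadamard_circuit :: "nat \<Rightarrow> nat list \<Rightarrow> nat list \<Rightarrow> gate list" where
  "hadamard_circuit q xs zs =
     map (Gate_CNOT q) xs @ map (\<lambda>t. Gate_CNOT t q) zs @ [Gate_H q] @
     map (\<lambda>t. Gate_CNOT t q) (rev zs) @ map (Gate_CNOT q) (rev xs)"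

lemma hadamard_circuit_Cons_x:
  "hadamard_circuit q (t # xs) zs = Gate_CNOT q t # hadamard_circuit q xs zs @ [Gate_CNOT q t]"
  by (simp add: hadamard_circuit_def)

lemma hadamard_circuit_Cons_z:
  "hadamard_circuit q [] (t # zs) = Gate_CNOT t q # hadamard_circuit q [] zs @ [Gate_CNOT t q]"
  by (simp add: hadamard_circuit_def)

definition indicator_vec :: "nat \<Rightarrow> nat set \<Rightarrow> bit vec" where
  "indicator_vec n A = vec n (\<lambda>p. of_bool (p \<in> A))"

lemma indicator_vec_carrier [simp]: "indicator_vec n A \<in> carrier_vec n"
  and indicator_vec_index [simp]: "p < n \<Longrightarrow> indicator_vec n A $ p = of_bool (p \<in> A)"
  by (simp_all add: indicator_vec_def)

lemma indicator_vec_insert: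
  "t \<notin> A \<Longrightarrow> indicator_vec n A + unit_vec n t = indicator_vec n (insert t A)"
  by (rule eq_vecI) (auto simp: indicator_vec_def unit_vec_def)

text \<open>Induction from the inside out. A gate from \<open>q\<close> to \<open>t\<close> adds
  \<open>t\<close> to the $X$ support, which contains \<open>q\<close>, and fixes the $Z$ support,
  which lacks \<open>t\<close>; gates onto \<open>q\<close> act with the roles exchanged.
  Distinctness of the qubits excludes every other update.\<close>

lemma circuit_op_hadamard_circuit:
  assumes "distinct (q # xs @ zs)" "set (q # xs @ zs) \<subseteq> {..<n}"
  shows "circuit_op n (hadamard_circuit q xs zs) =
    pauli_sum (indicator_vec n (insert q (set xs))) (indicator_vec n (insert q (set zs)))"
  using assms
proof (induction xs)
  case Nil
  then show ?case
  proof (induction zs)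
    case Nil
    have "indicator_vec n {q} = unit_vec n q"
      by (rule eq_vecI) (auto simp: indicator_vec_def unit_vec_def)
    moreover have "circuit_op n [Gate_H q] = apply_on n [q] mat_H"
      using left_mult_one_mat[OF apply_on_carrier[of n "[q]" mat_H]] by simp
    ultimately show ?case
      using Nil by (simp add: hadamard_circuit_def apply_on_H)
  next
    case (Cons t zs)
    \<comment> \<open>The control \<open>t\<close> lies outside the $X$ support, so the update of
      that support has coefficient 0.\<close>
    have "indicator_vec n {q} + 0 \<cdot>\<^sub>v unit_vec n q = indicator_vec n {q}"
      by (rule eq_vecI) (auto simp: indicator_vec_def)
    then show ?case
      using Cons unfolding hadamard_circuit_Cons_z circuit_op_conj
      by (auto simp: CNOT_conj_pauli_sum indicator_vec_insert insert_commute)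
  qed
next
  case (Cons t xs)
  have "indicator_vec n (insert q (set zs)) + 0 \<cdot>\<^sub>v unit_vec n q = indicator_vec n (insert q (set zs))"
    by (rule eq_vecI) (auto simp: indicator_vec_def)
  then show ?case
    using Cons unfolding hadamard_circuit_Cons_x circuit_op_conj
    by (auto simp: CNOT_conj_pauli_sum indicator_vec_insert insert_commute)
qed

section \<open>Conjugation of Pauli operators by the normalised sum\<close>

lemma pauli_sum_adjoint:
  assumes x: "x \<in> carrier_vec n" and z: "z \<in> carrier_vec n"
  shows "mat_adjoint (pauli_sum x z) = pauli_sum x z"
proof (rule eq_matI)
  note carr = pauli_sum_carrier[OF x z]
  fix r c assume "r < dim_row (pauli_sum x z)" "c < dim_col (pauli_sum x z)"
  then have rc: "r < 2 ^ n" "c < 2 ^ n"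
    using carr by auto
  then have "mat_adjoint (pauli_sum x z) $$ (r, c) = cnj (pauli_sum x z $$ (c, r))"
    using carr by (simp add: mat_adjoint_def mat_of_rows_index conjugate_complex_def)
  also have "\<dots> = pauli_sum x z $$ (r, c)"
    \<comment> \<open>All entries are real; the $X$ part is symmetric and the $Z$ part
      diagonal.\<close>
    using x z rc by (auto simp: pauli_sum_index bsign_def)
  finally show "mat_adjoint (pauli_sum x z) $$ (r, c) = pauli_sum x z $$ (r, c)" .
qed (use pauli_sum_carrier[OF x z] in \<open>auto simp: mat_adjoint_def\<close>)

text \<open>An odd overlap of the supports makes \<open>A\<close> and \<open>B\<close> anticommuting
  involutions. The cross terms of the square of \<open>A + B\<close> cancel, which leaves twice the
  identity, and the factor \<open>1 / sqrt 2\<close> normalises it.\<close>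

lemma pauli_sum_algebra:
  fixes x z :: "bit vec"
  defines "U \<equiv> pauli_sum x z" and "A \<equiv> pauli_op mat_X x" and "B \<equiv> pauli_op mat_Z z"
  assumes x: "x \<in> carrier_vec n" and z: "z \<in> carrier_vec n" and xz: "x \<bullet> z = 1"
  shows pauli_sum_square: "U * U = 1\<^sub>m (2 ^ n)"
    and pauli_sum_conj_X: "U * A * U = B"
    and pauli_sum_conj_Z: "U * B * U = A"
proof -
  let ?k = "complex_of_real (1 / sqrt 2)"
  have carr [simp]: "A \<in> carrier_mat (2 ^ n) (2 ^ n)" "B \<in> carrier_mat (2 ^ n) (2 ^ n)"
    "U \<in> carrier_mat (2 ^ n) (2 ^ n)"
    unfolding assms using x z by (auto intro: pauli_op_carrier pauli_sum_carrier)
  note [simp] = mult_carrier_mat[of _ "2 ^ n" "2 ^ n" _ "2 ^ n"]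
  have U: "U = ?k \<cdot>\<^sub>m (A + B)"
    unfolding assms pauli_sum_def ..
  have AA: "A * A = 1\<^sub>m (2 ^ n)" and BB: "B * B = 1\<^sub>m (2 ^ n)"
    and AB: "A * B = (- 1) \<cdot>\<^sub>m (B * A)"
    unfolding assms using pauli_X_square[OF x] pauli_Z_square[OF z] pauli_X_Z_commutation[OF x z] xz
    by simp_all
  have comm: "A + B = B + A"
    by (rule comm_add_mat[OF carr(1,2)])
  have UA: "U * A = B * U"
  proof -
    have "U * A = ?k \<cdot>\<^sub>m (A * A + B * A)"
      unfolding U by (simp add: mult_smult_assoc_mat[of _ "2 ^ n" "2 ^ n" _ "2 ^ n"] add_mult_distrib_mat[of _ "2 ^ n" "2 ^ n" _ _ "2 ^ n"])
    \<comment> \<open>Both squares are the identity, so \<open>A * A\<close> may be exchanged for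
      \<open>B * B\<close>.\<close>
    also have "\<dots> = ?k \<cdot>\<^sub>m (B * A + B * B)"
      unfolding AA BB by (subst comm_add_mat[of _ "2 ^ n" "2 ^ n"]) auto
    also have "\<dots> = B * U"
      unfolding U by (simp add: mult_smult_distrib[of _ "2 ^ n" "2 ^ n" _ "2 ^ n"] mult_add_distrib_mat[of _ "2 ^ n" "2 ^ n" _ "2 ^ n"])
    finally show ?thesis .
  qed
  have UB: "U * B = A * U"
  proof -
    have "U * B = ?k \<cdot>\<^sub>m (A * B + B * B)"
      unfolding U by (simp add: mult_smult_assoc_mat[of _ "2 ^ n" "2 ^ n" _ "2 ^ n"] add_mult_distrib_mat[of _ "2 ^ n" "2 ^ n" _ _ "2 ^ n"])
    also have "\<dots> = ?k \<cdot>\<^sub>m (A * A + A * B)"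
      unfolding AA BB by (subst comm_add_mat[of _ "2 ^ n" "2 ^ n"]) auto
    also have "\<dots> = A * U"
      unfolding U by (simp add: mult_smult_distrib[of _ "2 ^ n" "2 ^ n" _ "2 ^ n"] mult_add_distrib_mat[of _ "2 ^ n" "2 ^ n" _ "2 ^ n"])
    finally show ?thesis .
  qed
  have "U * U = ?k \<cdot>\<^sub>m ((A + B) * U)"
    by (subst (1) U) (simp add: mult_smult_assoc_mat[of _ "2 ^ n" "2 ^ n" _ "2 ^ n"])
  also have "(A + B) * U = ?k \<cdot>\<^sub>m ((A + B) * (A + B))"
    by (subst U) (simp add: mult_smult_distrib[of _ "2 ^ n" "2 ^ n" _ "2 ^ n"])
  also have "(A + B) * (A + B) = (A * A + B * A) + (A * B + B * B)"
    by (simp add: mult_add_distrib_mat[of _ "2 ^ n" "2 ^ n" _ "2 ^ n"]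
        add_mult_distrib_mat[of _ "2 ^ n" "2 ^ n" _ _ "2 ^ n"])
  also have "\<dots> = 2 \<cdot>\<^sub>m 1\<^sub>m (2 ^ n)"
    unfolding AA BB AB by (rule eq_matI) (use carr(1,2)[THEN carrier_matD(1)] carr(1,2)[THEN carrier_matD(2)] in \<open>auto simp del: index_mult_mat(1)\<close>)
  also have "?k \<cdot>\<^sub>m (?k \<cdot>\<^sub>m (2 \<cdot>\<^sub>m 1\<^sub>m (2 ^ n))) = 1\<^sub>m (2 ^ n)"
    by (rule eq_matI) (auto simp flip: of_real_mult)
  finally show UU: "U * U = 1\<^sub>m (2 ^ n)" .
  show "U * A * U = B" "U * B * U = A"
    unfolding UA UB by (simp_all add: assoc_mult_mat[of _ "2 ^ n" "2 ^ n" _ "2 ^ n" _ "2 ^ n"] UU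
        right_mult_one_mat[of _ "2 ^ n" "2 ^ n"])
qed

text \<open>An operator that commutes with both summands commutes with their sum, which is its own
  inverse.\<close>

lemma pauli_sum_conj_commuting:
  assumes x: "x \<in> carrier_vec n" and z: "z \<in> carrier_vec n" and xz: "x \<bullet> z = 1"
    and P: "P \<in> carrier_mat (2 ^ n) (2 ^ n)"
    and comm: "pauli_op mat_X x * P = P * pauli_op mat_X x" "pauli_op mat_Z z * P = P * pauli_op mat_Z z"
  shows "pauli_sum x z * P * pauli_sum x z = P"
proof -
  let ?U = "pauli_sum x z"
  note carr = pauli_op_carrier[OF x] pauli_op_carrier[OF z] pauli_sum_carrier[OF x z] P
  have "?U * P = P * ?U"
    unfolding pauli_sum_def using carr comm
    by (simp add: mult_smult_assoc_mat[of _ "2 ^ n" "2 ^ n" _ "2 ^ n"]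
        mult_smult_distrib[of _ "2 ^ n" "2 ^ n" _ "2 ^ n"] add_mult_distrib_mat[of _ "2 ^ n" "2 ^ n" _ _ "2 ^ n"]
        mult_add_distrib_mat[of _ "2 ^ n" "2 ^ n" _ "2 ^ n"])
  then show ?thesis
    using carr pauli_sum_square[OF x z xz] by (simp add: assoc_mult_mat[of _ "2 ^ n" "2 ^ n" _ "2 ^ n" _ "2 ^ n"])
qed

section \<open>Depth and support\<close>

text \<open>The qubits with nontrivial action form an admissible set contained in every admissible
  one, so the least set exists and is this one.\<close>

lemma circuit_support_eq:
  "circuit_support n C = {q. q < n \<and> \<not> acts_as_identity_on n (circuit_op n C) q}"
  unfolding circuit_support_def by (rule Least_equality) auto

text \<open>Any two gates overlap at \<open>q\<close>, so layers increase strictly along the list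
  and are pairwise distinct; one gate per layer attains the bound.\<close>

lemma circuit_depth_common_qubit:
  assumes q: "\<And>g. g \<in> set C \<Longrightarrow> q \<in> set (gate_qubits g)"
  shows "circuit_depth C = length C"
  unfolding circuit_depth_def
proof (rule Least_equality)
  show "\<exists>layer. (\<forall>s<length C. layer s < length C) \<and>
      (\<forall>t<length C. \<forall>s<t. overlap (C ! s) (C ! t) \<longrightarrow> layer s < layer t)"
    by (rule exI[of _ "\<lambda>s. s"]) simp
next
  fix d :: nat assume "\<exists>layer. (\<forall>s<length C. layer s < d) \<and>
      (\<forall>t<length C. \<forall>s<t. overlap (C ! s) (C ! t) \<longrightarrow> layer s < layer t)"
  then obtain layer :: "nat \<Rightarrow> nat" where bound: "\<forall>s<length C. layer s < d"
    and mono: "\<forall>t<length C. \<forall>s<t. overlap (C ! s) (C ! t) \<longrightarrow> layer s < layer t"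
    by blast
  have "overlap (C ! s) (C ! t)" if "t < length C" "s < t" for s t
    using q[of "C ! s"] q[of "C ! t"] that by (auto simp: overlap_def)
  with mono have "inj_on layer {..<length C}"
    by (intro linorder_inj_onI) (auto simp: less_imp_neq)
  moreover have "layer ` {..<length C} \<subseteq> {..<d}"
    using bound by auto
  ultimately show "length C \<le> d"
    by (metis card_inj_on_le card_lessThan finite_lessThan)
qed

lemma acts_as_identity_pauli_sum:
  assumes x: "x \<in> carrier_vec n" and z: "z \<in> carrier_vec n" and q: "q < n" "x $ q = 0" "z $ q = 0"
  shows "acts_as_identity_on n (pauli_sum x z) q"
  unfolding acts_as_identity_on_def
\<comment> \<open>The operator on the remaining qubits is read off from the same matrix at the
  indices with digit \<open>q\<close> cleared. Outside both supports, digit \<open>q\<close> affects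
  no sign, and nonzero entries need it to agree.\<close>
proof (intro exI[of _ "\<lambda>r c. pauli_sum x z $$ (r, c)"] allI impI)
  fix r c :: nat assume rc: "r < 2 ^ n" "c < 2 ^ n"
  let ?r = "unset_bit q r" and ?c = "unset_bit q c"
  have rc': "?r < 2 ^ n" "?c < 2 ^ n"
    using rc by (auto intro: unset_bit_less_exp)
  have X: "(\<forall>p<n. bit r p \<noteq> bit c p \<longleftrightarrow> x $ p = 1) \<longleftrightarrow>
      bit r q = bit c q \<and> (\<forall>p<n. bit ?r p \<noteq> bit ?c p \<longleftrightarrow> x $ p = 1)"
    using q by (auto simp: bit_unset_bit_iff)
  have "r = c \<longleftrightarrow> (\<forall>p<n. bit r p = bit c p)"
    using nat_eq_of_bits[OF rc] by blast
  also have "\<dots> \<longleftrightarrow> bit r q = bit c q \<and> (\<forall>p<n. bit ?r p = bit ?c p)"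
    using q by (auto simp: bit_unset_bit_iff)
  also have "(\<forall>p<n. bit ?r p = bit ?c p) \<longleftrightarrow> ?r = ?c"
    using nat_eq_of_bits[OF rc'] by auto
  finally have Z: "r = c \<longleftrightarrow> bit r q = bit c q \<and> ?r = ?c" .
  have "z \<bullet> bits n r = z \<bullet> bits n ?r"
    unfolding scalar_prod_def dim_bits
  proof (rule sum.cong[OF refl])
    fix p assume "p \<in> {0..<n}"
    then show "z $ p * bits n r $ p = z $ p * bits n ?r $ p"
      using q by (cases "p = q") (simp_all add: bit_unset_bit_iff)
  qed
  then show "pauli_sum x z $$ (r, c) = of_bool (bit r q = bit c q) * pauli_sum x z $$ (?r, ?c)"
    unfolding pauli_sum_index[OF x z rc] pauli_sum_index[OF x z rc'] X Z by simp
qed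

text \<open>The entry at row \<open>flip x 0\<close> and column 0 is \<open>1 / sqrt 2\<close>,
  since it is off the diagonal and only the $X$ part contributes. The two indices differ in digit
  \<open>q\<close>, so the identity on \<open>q\<close> would force this entry to be 0.\<close>

lemma not_acts_as_identity_pauli_sum:
  assumes x: "x \<in> carrier_vec n" and z: "z \<in> carrier_vec n" and q: "q < n" "x $ q = 1"
  shows "\<not> acts_as_identity_on n (pauli_sum x z) q"
proof
  assume "acts_as_identity_on n (pauli_sum x z) q"
  then obtain V where "\<forall>r<2 ^ n. \<forall>c<2 ^ n. pauli_sum x z $$ (r, c) =
      of_bool (bit r q = bit c q) * V (unset_bit q r) (unset_bit q c)"
    unfolding acts_as_identity_on_def by blast
  moreover have less: "flip x 0 < 2 ^ n" "(0 :: nat) < 2 ^ n"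
    using flip_less[OF x] by auto
  moreover have neq: "bit (flip x 0) q \<noteq> bit (0 :: nat) q"
    using x q by (simp add: bit_flip)
  ultimately have "pauli_sum x z $$ (flip x 0, 0) = 0"
    by simp
  moreover have "(\<forall>p<n. bit (flip x 0) p \<noteq> bit (0 :: nat) p \<longleftrightarrow> x $ p = 1) = True"
    using x by (simp add: bit_flip)
  moreover have "(flip x 0 = 0) = False"
    using neq by metis
  ultimately show False
    unfolding pauli_sum_index[OF x z less] by (simp only: of_bool_eq) simp
qed

section \<open>The circuit for two supports that cross in one qubit\<close>

definition other_ones :: "bit vec \<Rightarrow> nat \<Rightarrow> nat list" where
  "other_ones v q = filter (\<lambda>p. v $ p = 1 \<and> p \<noteq> q) [0..<dim_vec v]"

lemma set_other_ones: "set (other_ones v q) = {p. p < dim_vec v \<and> v $ p = 1} - {q}"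
  by (auto simp: other_ones_def)

lemma length_other_ones:
  assumes "q < dim_vec v" "v $ q = 1"
  shows "Suc (length (other_ones v q)) = hamming_weight v"
proof -
  have "length (other_ones v q) = card ({p. p < dim_vec v \<and> v $ p = 1} - {q})"
    by (metis other_ones_def distinct_card distinct_filter distinct_upt set_other_ones)
  then show ?thesis
    using assms card_Suc_Diff1[of "{p. p < dim_vec v \<and> v $ p = 1}" q] by (simp add: hamming_weight_def)
qed

text \<open>The single crossing serves twice: the overlap is odd, so the two operators anticommute,
  and the supports are disjoint away from \<open>q\<close>, as the circuit requires.\<close>

locale crossing_supports =
  fixes n :: nat and x z :: "bit vec" and q :: nat
  assumes x: "x \<in> carrier_vec n" and z: "z \<in> carrier_vec n"
    and q: "q < n" "x $ q = 1" "z $ q = 1"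
    and only_q: "\<And>p. p < n \<Longrightarrow> x $ p = 1 \<Longrightarrow> z $ p = 1 \<Longrightarrow> p = q"
begin

abbreviation "circuit \<equiv> hadamard_circuit q (other_ones x q) (other_ones z q)"

lemma scalar_prod_eq_1: "x \<bullet> z = 1"
proof -
  have "x \<bullet> z = (\<Sum>p = 0..<n. if p = q then 1 else 0)"
    unfolding scalar_prod_def using z
  proof (intro sum.cong)
    fix p assume "p \<in> {0..<n}"
    then show "x $ p * z $ p = (if p = q then 1 else 0)"
      using q only_q[of p] by (cases "x $ p"; cases "z $ p") auto
  qed auto
  then show ?thesis
    using q by simp
qed

lemma disjoint: "distinct (q # other_ones x q @ other_ones z q)"
  "set (q # other_ones x q @ other_ones z q) \<subseteq> {..<n}"
proof -
  have "distinct (other_ones v q)" for v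
    by (simp add: other_ones_def)
  moreover have "set (other_ones x q) \<inter> set (other_ones z q) = {}"
    using x z only_q unfolding set_other_ones by fastforce
  ultimately show "distinct (q # other_ones x q @ other_ones z q)"
    by (simp add: set_other_ones)
  show "set (q # other_ones x q @ other_ones z q) \<subseteq> {..<n}"
    using q x z by (auto simp: set_other_ones)
qed

lemma circuit_op_eq: "circuit_op n circuit = pauli_sum x z"
proof -
  have "indicator_vec n (insert q (set (other_ones v q))) = v"
    if "v \<in> carrier_vec n" "v $ q = 1" for v
    using that q(1) by (intro eq_vecI) (auto simp: indicator_vec_def set_other_ones)
  then show ?thesis
    using circuit_op_hadamard_circuit[OF disjoint] x z q by simp
qed

lemma is_circuit: "is_circuit n circuit"
  using disjoint by (auto simp: is_circuit_def hadamard_circuit_def)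

text \<open>Each list of partners of \<open>q\<close> is one shorter than the corresponding weight,
  so the number of gates is twice the sum of the weights minus 3. Both weights are at least
  1.\<close>

lemma depth_bounds:
  "hamming_weight x \<le> circuit_depth circuit"
  "circuit_depth circuit \<le> 2 * (hamming_weight x + hamming_weight z)"
proof -
  have "circuit_depth circuit = length circuit"
    by (rule circuit_depth_common_qubit[of _ q]) (auto simp: hadamard_circuit_def)
  also have "\<dots> = Suc (2 * (length (other_ones x q) + length (other_ones z q)))"
    by (simp add: hadamard_circuit_def)
  finally show "hamming_weight x \<le> circuit_depth circuit"
    "circuit_depth circuit \<le> 2 * (hamming_weight x + hamming_weight z)"
    using length_other_ones[of q x] length_other_ones[of q z] x z q by auto
qed

text \<open>The support contains that of \<open>x\<close>, which suffices for the lower bound, and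
  lies in the union of the supports of \<open>x\<close> and \<open>z\<close>.\<close>

lemma support_bounds:
  "hamming_weight x \<le> support_size n circuit"
  "support_size n circuit \<le> hamming_weight x + hamming_weight z"
proof -
  let ?X = "{p. p < dim_vec x \<and> x $ p = 1}" and ?Z = "{p. p < dim_vec z \<and> z $ p = 1}"
  let ?S = "circuit_support n circuit"
  have lower: "?X \<subseteq> ?S"
    using not_acts_as_identity_pauli_sum[OF x z] x by (auto simp: circuit_support_eq circuit_op_eq)
  have upper: "?S \<subseteq> ?X \<union> ?Z"
  proof
    fix p assume "p \<in> ?S"
    then have "p < n" and nontrivial: "\<not> acts_as_identity_on n (pauli_sum x z) p"
      by (simp_all add: circuit_support_eq circuit_op_eq)
    moreover have "x $ p = 1 \<or> z $ p = 1"
      using acts_as_identity_pauli_sum[OF x z \<open>p < n\<close>] nontrivial by (metis bit_not_one_iff)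
    ultimately
    show "p \<in> ?X \<union> ?Z"
      using x z by auto
  qed
  have "finite ?S"
    by (simp add: circuit_support_eq)
  with lower show "hamming_weight x \<le> support_size n circuit"
    by (simp add: hamming_weight_def support_size_def card_mono)
  have "card ?S \<le> card (?X \<union> ?Z)"
    using upper by (intro card_mono) auto
  also have "\<dots> \<le> card ?X + card ?Z"
    by (rule card_Un_le)
  finally show "support_size n circuit \<le> hamming_weight x + hamming_weight z"
    by (simp add: hamming_weight_def support_size_def)
qed

lemma conj_X:
  "circuit_op n circuit * pauli_op mat_X x * mat_adjoint (circuit_op n circuit) = pauli_op mat_Z z"
  using pauli_sum_conj_X[OF x z scalar_prod_eq_1] by (simp add: circuit_op_eq pauli_sum_adjoint[OF x z])

lemma conj_Z:
  "circuit_op n circuit * pauli_op mat_Z z * mat_adjoint (circuit_op n circuit) = pauli_op mat_X x"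
  using pauli_sum_conj_Z[OF x z scalar_prod_eq_1] by (simp add: circuit_op_eq pauli_sum_adjoint[OF x z])

text \<open>Operators of equal type always commute, so the scalar product with \<open>z\<close> is
  the only condition to check.\<close>

lemma conj_other_X:
  assumes w: "w \<in> carrier_vec n" and wz: "w \<bullet> z = 0"
  shows "circuit_op n circuit * pauli_op mat_X w * mat_adjoint (circuit_op n circuit) = pauli_op mat_X w"
proof -
  have "pauli_op mat_X w * pauli_op mat_Z z = 1 \<cdot>\<^sub>m (pauli_op mat_Z z * pauli_op mat_X w)"
    using pauli_X_Z_commutation[OF w z] wz by simp
  also have "\<dots> = pauli_op mat_Z z * pauli_op mat_X w"
    by (rule eq_matI) auto
  finally show ?thesis
    unfolding circuit_op_eq pauli_sum_adjoint[OF x z]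
    by (intro pauli_sum_conj_commuting[OF x z scalar_prod_eq_1 pauli_op_carrier[OF w]]
        pauli_X_commute[OF x w]) simp
qed

lemma conj_other_Z:
  assumes w: "w \<in> carrier_vec n" and xw: "x \<bullet> w = 0"
  shows "circuit_op n circuit * pauli_op mat_Z w * mat_adjoint (circuit_op n circuit) = pauli_op mat_Z w"
proof -
  have "pauli_op mat_X x * pauli_op mat_Z w = 1 \<cdot>\<^sub>m (pauli_op mat_Z w * pauli_op mat_X x)"
    using pauli_X_Z_commutation[OF x w] xw by simp
  also have "\<dots> = pauli_op mat_Z w * pauli_op mat_X x"
    by (rule eq_matI) auto
  finally show ?thesis
    unfolding circuit_op_eq pauli_sum_adjoint[OF x z]
    by (intro pauli_sum_conj_commuting[OF x z scalar_prod_eq_1 pauli_op_carrier[OF w]]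
        pauli_Z_commute[OF z w])
qed

end

section \<open>Hypergraph product codes\<close>

lemma slt_vec_in_kernel:
  assumes "is_slt_basis A B" "i \<in> pivots B"
  shows "slt_vec B i \<in> mat_kernel A"
proof -
  interpret kernel "dim_row A" "dim_col A" A
    by unfold_locales auto
  show ?thesis
    using assms unfolding is_slt_basis_def Ker.basis_def by auto
qed

section \<open>Tensor products of bit vectors\<close>

lemma sum_div_mod:
  fixes f g :: "nat \<Rightarrow> 'a :: comm_semiring_0"
  shows "(\<Sum>p<a * b. f (p div b) * g (p mod b)) = (\<Sum>i<a. f i) * (\<Sum>j<b. g j)"
proof -
  have "(\<Sum>p<a * b. f (p div b) * g (p mod b)) =
      (\<Sum>i<a. \<Sum>p = i * b..<i * b + b. f (p div b) * g (p mod b))"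
    \<comment> \<open>The indices with quotient \<open>i\<close> form a block of length
      \<open>b\<close>.\<close>
    by (rule sum.nat_group[symmetric])
  also have "\<dots> = (\<Sum>i<a. \<Sum>j<b. f i * g j)"
  proof (rule sum.cong[OF refl])
    fix i
    have "p div b = i" "p mod b = p - i * b" if "i * b \<le> p" "p < i * b + b" for p
    proof -
      show "p div b = i"
        using that by (intro div_nat_eqI) (simp_all add: mult.commute)
      then show "p mod b = p - i * b"
        by (metis minus_div_mult_eq_mod)
    qed
    then show "(\<Sum>p = i * b..<i * b + b. f (p div b) * g (p mod b)) = (\<Sum>j<b. f i * g j)"
      by (intro sum.reindex_bij_witness[of _ "\<lambda>j. i * b + j" "\<lambda>p. p - i * b"]) auto
  qed
  finally show ?thesis
    by (simp add: sum_product)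
qed

lemma vec_tensor_carrier: "u \<in> carrier_vec a \<Longrightarrow> v \<in> carrier_vec b \<Longrightarrow> u \<otimes>\<^sub>v v \<in> carrier_vec (a * b)"
  by (auto simp: vec_tensor_def)

lemma vec_tensor_row_carrier: "row A r \<otimes>\<^sub>v row B s \<in> carrier_vec (dim_col A * dim_col B)"
  by (intro vec_tensor_carrier row_carrier)

lemma scalar_prod_vec_tensor:
  fixes u :: "'a :: comm_semiring_1 vec"
  assumes "u \<in> carrier_vec a" "u' \<in> carrier_vec a" "v \<in> carrier_vec b" "v' \<in> carrier_vec b"
  shows "(u \<otimes>\<^sub>v v) \<bullet> (u' \<otimes>\<^sub>v v') = (u \<bullet> u') * (v \<bullet> v')"
proof -
  have "(u \<otimes>\<^sub>v v) \<bullet> (u' \<otimes>\<^sub>v v') =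
      (\<Sum>p<a * b. (u $ (p div b) * u' $ (p div b)) * (v $ (p mod b) * v' $ (p mod b)))"
    using assms by (auto simp: scalar_prod_def vec_tensor_def lessThan_atLeast0 ac_simps intro!: sum.cong)
  also have "\<dots> = (\<Sum>i<a. u $ i * u' $ i) * (\<Sum>j<b. v $ j * v' $ j)"
    by (rule sum_div_mod)
  finally show ?thesis
    using assms by (simp add: scalar_prod_def lessThan_atLeast0)
qed

lemma hamming_weight_eq_sum: "hamming_weight v = (\<Sum>p<dim_vec v. of_bool (v $ p = 1))"
  by (simp add: hamming_weight_def Int_def)

text \<open>A product of bits is 1 exactly when both factors are, so the count factors over quotient
  and remainder.\<close>

lemma hamming_weight_vec_tensor: "hamming_weight (u \<otimes>\<^sub>v v) = hamming_weight u * hamming_weight v"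
proof -
  have "hamming_weight (u \<otimes>\<^sub>v v) = (\<Sum>p<dim_vec u * dim_vec v.
      of_bool (u $ (p div dim_vec v) = 1) * of_bool (v $ (p mod dim_vec v) = 1))"
    unfolding hamming_weight_eq_sum by (intro sum.cong) (auto simp: vec_tensor_def)
  also have "\<dots> = (\<Sum>i<dim_vec u. of_bool (u $ i = 1)) * (\<Sum>j<dim_vec v. of_bool (v $ j = 1))"
    by (rule sum_div_mod)
  finally show ?thesis
    unfolding hamming_weight_eq_sum .
qed

lemma hamming_weight_unit_vec: "i < n \<Longrightarrow> hamming_weight (unit_vec n i) = 1"
proof -
  assume "i < n"
  then have "{p. p < n \<and> (unit_vec n i :: bit vec) $ p = 1} = {i}"
    by (auto split: if_splits)
  then show ?thesis
    by (simp add: hamming_weight_def)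
qed

lemma hamming_weight_left_vec: "hamming_weight (left_vec Q v) = hamming_weight v"
proof -
  have "{p. p < dim_vec v + ma Q * mb Q \<and> (v @\<^sub>v 0\<^sub>v (ma Q * mb Q)) $ p = 1} =
      {p. p < dim_vec v \<and> v $ p = 1}"
    by (auto simp: index_append_vec(1) split: if_splits)
  then show ?thesis
    by (simp add: hamming_weight_def left_vec_def)
qed

section \<open>Rows of the check matrices and the two sectors\<close>

lemma dim_mat_tensor [simp]:
  "dim_row (A \<otimes>\<^sub>m B) = dim_row A * dim_row B" "dim_col (A \<otimes>\<^sub>m B) = dim_col A * dim_col B"
  by (simp_all add: mat_tensor_def)

text \<open>Brings stabilizer rows into tensor form, so that their scalar products with logical
  operators factor.\<close>

lemma row_mat_tensor:
  "r < dim_row A * dim_row B \<Longrightarrow> row (A \<otimes>\<^sub>m B) r = row A (r div dim_row B) \<otimes>\<^sub>v row B (r mod dim_row B)"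
proof (rule eq_vecI)
  fix c assume r: "r < dim_row A * dim_row B"
    and "c < dim_vec (row A (r div dim_row B) \<otimes>\<^sub>v row B (r mod dim_row B))"
  then have c: "c < dim_col A * dim_col B"
    by (simp add: vec_tensor_def)
  then have "c mod dim_col B < dim_col B"
    by (cases "dim_col B") simp_all
  with r c show "row (A \<otimes>\<^sub>m B) r $ c = (row A (r div dim_row B) \<otimes>\<^sub>v row B (r mod dim_row B)) $ c"
    by (simp add: mat_tensor_def vec_tensor_def row_def less_mult_imp_div_less)
qed (simp add: mat_tensor_def vec_tensor_def)

lemma row_append_cols:
  assumes "dim_row A = dim_row B" "r < dim_row A"
  shows "row (A @\<^sub>c B) r = row A r @\<^sub>v row B r"
  using assms by (intro eq_vecI) (auto simp: append_cols_def)

lemma left_vec_carrier: "v \<in> carrier_vec (na Q * nb Q) \<Longrightarrow> left_vec Q v \<in> carrier_vec (code_length Q)"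
  by (auto simp: left_vec_def code_length_def)

lemma right_vec_carrier: "v \<in> carrier_vec (ma Q * mb Q) \<Longrightarrow> right_vec Q v \<in> carrier_vec (code_length Q)"
  by (auto simp: right_vec_def code_length_def)

lemma left_vec_index:
  assumes "v \<in> carrier_vec (na Q * nb Q)" "p < code_length Q"
  shows "left_vec Q v $ p = (if p < na Q * nb Q then v $ p else 0)"
  using assms by (auto simp: left_vec_def code_length_def)

lemma scalar_prod_append_left_vec:
  assumes "u \<in> carrier_vec (na Q * nb Q)" "u' \<in> carrier_vec (ma Q * mb Q)"
    "v \<in> carrier_vec (na Q * nb Q)"
  shows "(u @\<^sub>v u') \<bullet> left_vec Q v = u \<bullet> v"
  unfolding left_vec_def using assms by (subst scalar_prod_append) auto

lemma scalar_prod_left_left_vec: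
  assumes "u \<in> carrier_vec (na Q * nb Q)" "v \<in> carrier_vec (na Q * nb Q)"
  shows "left_vec Q u \<bullet> left_vec Q v = u \<bullet> v"
  using scalar_prod_append_left_vec[OF assms(1) zero_carrier_vec assms(2)]
  unfolding left_vec_def[of Q u] .

lemma scalar_prod_right_left_vec:
  assumes "u \<in> carrier_vec (ma Q * mb Q)" "v \<in> carrier_vec (na Q * nb Q)"
  shows "right_vec Q u \<bullet> left_vec Q v = 0"
  using scalar_prod_append_left_vec[OF zero_carrier_vec assms] assms(2)
  unfolding right_vec_def by simp

lemma set_rows: "set (rows A) = row A ` {..<dim_row A}"
  by (auto simp: rows_def)

section \<open>A fixed logical qubit of the left sector\<close>

locale left_logical_qubit =
  fixes Q :: hgp and i h :: nat
  assumes slt: "has_slt_bases Q"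
    and i: "i \<in> pivots (slt_a Q)" and h: "h \<in> pivots (slt_b Q)"
begin

abbreviation "a \<equiv> slt_vec (slt_a Q)"
abbreviation "b \<equiv> slt_vec (slt_b Q)"
abbreviation "X_vec \<equiv> left_vec Q (unit_vec (na Q) i \<otimes>\<^sub>v b h)"
abbreviation "Z_vec \<equiv> left_vec Q (a i \<otimes>\<^sub>v unit_vec (nb Q) h)"

lemma a_carrier: "i' \<in> pivots (slt_a Q) \<Longrightarrow> a i' \<in> carrier_vec (na Q)"
  and b_carrier: "h' \<in> pivots (slt_b Q) \<Longrightarrow> b h' \<in> carrier_vec (nb Q)"
  and \<alpha>_carrier: "j \<in> pivots (slt_\<alpha> Q) \<Longrightarrow> slt_vec (slt_\<alpha> Q) j \<in> carrier_vec (ma Q)"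
  and \<beta>_carrier: "l \<in> pivots (slt_\<beta> Q) \<Longrightarrow> slt_vec (slt_\<beta> Q) l \<in> carrier_vec (mb Q)"
  using slt slt_vec_in_kernel unfolding has_slt_bases_def mat_kernel_def by fastforce+

lemma a_codeword: "Ha Q *\<^sub>v a i = 0\<^sub>v (ma Q)"
  and b_codeword: "Hb Q *\<^sub>v b h = 0\<^sub>v (mb Q)"
  using slt i h slt_vec_in_kernel unfolding has_slt_bases_def mat_kernel_def by fastforce+

lemma pivot_less: "i' \<in> pivots (slt_a Q) \<Longrightarrow> i' < na Q" "h' \<in> pivots (slt_b Q) \<Longrightarrow> h' < nb Q"
  using slt unfolding has_slt_bases_def is_slt_basis_def by auto

lemma a_pivot: "i' \<in> pivots (slt_a Q) \<Longrightarrow> i'' \<in> pivots (slt_a Q) \<Longrightarrow> a i' $ i'' = of_bool (i' = i'')"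
  and b_pivot: "h' \<in> pivots (slt_b Q) \<Longrightarrow> h'' \<in> pivots (slt_b Q) \<Longrightarrow> b h' $ h'' = of_bool (h' = h'')"
  using slt unfolding has_slt_bases_def is_slt_basis_def by auto

lemmas tensor_carrier =
  vec_tensor_carrier[OF unit_vec_carrier b_carrier] vec_tensor_carrier[OF a_carrier unit_vec_carrier]

text \<open>On the grid of the left sector, \<open>X_vec\<close> lives on the line with quotient
  \<open>i\<close> and \<open>Z_vec\<close> on the line with remainder \<open>h\<close>. The lines
  meet in one point, where both entries are 1 because \<open>i\<close> and \<open>h\<close> are
  pivots of their own basis vectors.\<close>

lemma crossing: "crossing_supports (code_length Q) X_vec Z_vec (i * nb Q + h)"
proof
  note less = pivot_less(1)[OF i] pivot_less(2)[OF h]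
  note tensors = tensor_carrier(1)[OF h, of "na Q" i] tensor_carrier(2)[OF i, of "nb Q" h]
  show "X_vec \<in> carrier_vec (code_length Q)" "Z_vec \<in> carrier_vec (code_length Q)"
    using tensors by (intro left_vec_carrier; simp)+
  have "i * nb Q + h < Suc i * nb Q"
    using less by simp
  also have "\<dots> \<le> na Q * nb Q"
    using less by (intro mult_le_mono1) simp
  finally have q: "i * nb Q + h < na Q * nb Q" .
  then show q': "i * nb Q + h < code_length Q"
    by (simp add: code_length_def)
  have X: "X_vec $ p = (if p < na Q * nb Q then of_bool (p div nb Q = i) * b h $ (p mod nb Q) else 0)"
    and Z: "Z_vec $ p = (if p < na Q * nb Q then a i $ (p div nb Q) * of_bool (p mod nb Q = h) else 0)"
    if "p < code_length Q" for p
  proof -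
    have "p div nb Q < na Q" "p mod nb Q < nb Q" if "p < na Q * nb Q"
      using that less(2) by (simp_all add: less_mult_imp_div_less)
    then show "X_vec $ p = (if p < na Q * nb Q then of_bool (p div nb Q = i) * b h $ (p mod nb Q) else 0)"
      "Z_vec $ p = (if p < na Q * nb Q then a i $ (p div nb Q) * of_bool (p mod nb Q = h) else 0)"
      using less that tensors a_carrier[OF i] b_carrier[OF h]
      by (simp_all add: left_vec_index) (auto simp: vec_tensor_def unit_vec_def)
  qed
  show "X_vec $ (i * nb Q + h) = 1" "Z_vec $ (i * nb Q + h) = 1"
    using q less X[OF q'] Z[OF q'] a_pivot[OF i i] b_pivot[OF h h] by simp_all
  show "p = i * nb Q + h" if p: "p < code_length Q" and "X_vec $ p = 1" "Z_vec $ p = 1" for p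
  proof -
    have "p div nb Q = i" "p mod nb Q = h"
      using that(2,3) unfolding X[OF p] Z[OF p]
      by (cases "p div nb Q = i"; cases "p mod nb Q = h"; simp split: if_splits)+
    then show ?thesis
      by (metis div_mult_mod_eq)
  qed
qed

sublocale crossing_supports "code_length Q" X_vec Z_vec "i * nb Q + h"
  by (rule crossing)

lemma weights: "hamming_weight X_vec = hamming_weight (b h)" "hamming_weight Z_vec = hamming_weight (a i)"
  using pivot_less i h
  by (simp_all add: hamming_weight_left_vec hamming_weight_vec_tensor hamming_weight_unit_vec)

text \<open>The left block of a row is a row of \<open>Ha Q\<close> tensored with a unit vector. Its
  product with \<open>Z_vec\<close> has a factor that is a coordinate of
  \<open>Ha Q *\<^sub>v a i\<close>, hence 0; the right block meets only zeros.\<close>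

lemma HX_row_Z:
  assumes "r < dim_row (HX Q)"
  shows "row (HX Q) r \<in> carrier_vec (code_length Q)" "row (HX Q) r \<bullet> Z_vec = 0"
proof -
  let ?r = "r div nb Q" and ?s = "r mod nb Q"
  have r: "r < ma Q * nb Q"
    using assms by (simp add: HX_def append_cols_def)
  let ?u = "row (Ha Q) ?r \<otimes>\<^sub>v row (1\<^sub>m (nb Q)) ?s"
  let ?u' = "row (1\<^sub>m (ma Q)) ?r \<otimes>\<^sub>v row (transpose_mat (Hb Q)) ?s"
  have row: "row (HX Q) r = ?u @\<^sub>v ?u'"
    unfolding HX_def using r by (subst row_append_cols) (simp_all add: row_mat_tensor)
  have u: "?u \<in> carrier_vec (na Q * nb Q)" and u': "?u' \<in> carrier_vec (ma Q * mb Q)"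
    using vec_tensor_row_carrier[of "Ha Q" ?r "1\<^sub>m (nb Q)" ?s]
      vec_tensor_row_carrier[of "1\<^sub>m (ma Q)" ?r "transpose_mat (Hb Q)" ?s] by simp_all
  show "row (HX Q) r \<in> carrier_vec (code_length Q)"
    unfolding row code_length_def using u u' by auto
  have "row (Ha Q) ?r \<bullet> a i = (Ha Q *\<^sub>v a i) $ ?r"
    using r by (simp add: less_mult_imp_div_less)
  also have "\<dots> = 0"
    using r by (simp add: a_codeword less_mult_imp_div_less)
  finally have "?u \<bullet> (a i \<otimes>\<^sub>v unit_vec (nb Q) h) = 0"
    using row_carrier[of "1\<^sub>m (nb Q)" ?s]
    by (subst scalar_prod_vec_tensor[of _ "na Q" _ _ "nb Q"]) (simp_all add: a_carrier[OF i])
  then show "row (HX Q) r \<bullet> Z_vec = 0"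
    unfolding row using scalar_prod_append_left_vec[OF u u' tensor_carrier(2)[OF i]] by simp
qed

lemma HZ_row_X:
  assumes "r < dim_row (HZ Q)"
  shows "row (HZ Q) r \<in> carrier_vec (code_length Q)" "row (HZ Q) r \<bullet> X_vec = 0"
proof -
  let ?r = "r div mb Q" and ?s = "r mod mb Q"
  have r: "r < na Q * mb Q"
    using assms by (simp add: HZ_def append_cols_def)
  \<comment> \<open>Here the parity check is the second tensor factor, so its row index is a
    remainder; the bound on \<open>r\<close> excludes \<open>mb Q = 0\<close>.\<close>
  then have s: "?s < mb Q"
    by (cases "mb Q") simp_all
  let ?u = "row (1\<^sub>m (na Q)) ?r \<otimes>\<^sub>v row (Hb Q) ?s"
  let ?u' = "row (transpose_mat (Ha Q)) ?r \<otimes>\<^sub>v row (1\<^sub>m (mb Q)) ?s"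
  have row: "row (HZ Q) r = ?u @\<^sub>v ?u'"
    unfolding HZ_def using r by (subst row_append_cols) (simp_all add: row_mat_tensor)
  have u: "?u \<in> carrier_vec (na Q * nb Q)" and u': "?u' \<in> carrier_vec (ma Q * mb Q)"
    using vec_tensor_row_carrier[of "1\<^sub>m (na Q)" ?r "Hb Q" ?s]
      vec_tensor_row_carrier[of "transpose_mat (Ha Q)" ?r "1\<^sub>m (mb Q)" ?s] by simp_all
  show "row (HZ Q) r \<in> carrier_vec (code_length Q)"
    unfolding row code_length_def using u u' by auto
  have "row (Hb Q) ?s \<bullet> b h = (Hb Q *\<^sub>v b h) $ ?s"
    using s by simp
  also have "\<dots> = 0"
    using s by (simp add: b_codeword)
  finally have "?u \<bullet> (unit_vec (na Q) i \<otimes>\<^sub>v b h) = 0"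
    using row_carrier[of "1\<^sub>m (na Q)" ?r]
    by (subst scalar_prod_vec_tensor[of _ "na Q" _ _ "nb Q"]) (simp_all add: b_carrier[OF h])
  then show "row (HZ Q) r \<bullet> X_vec = 0"
    unfolding row using scalar_prod_append_left_vec[OF u u' tensor_carrier(1)[OF h]] by simp
qed

lemma stabilizer_fixed:
  assumes "S \<in> stabilizer_generators Q"
  shows "circuit_op (code_length Q) circuit * S * mat_adjoint (circuit_op (code_length Q) circuit) = S"
proof -
  consider r where "r < dim_row (HX Q)" "S = pauli_op mat_X (row (HX Q) r)"
    | r where "r < dim_row (HZ Q)" "S = pauli_op mat_Z (row (HZ Q) r)"
    using assms unfolding stabilizer_generators_def set_rows by blast
  then show ?thesis
  proof cases
    case 1
    then show ?thesis
      using HX_row_Z by (simp add: conj_other_X)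
  next
    case (2 r)
    then have "X_vec \<bullet> row (HZ Q) r = 0"
      using HZ_row_X(2) comm_scalar_prod[OF x HZ_row_X(1)] by simp
    with 2 show ?thesis
      using HZ_row_X(1) by (simp add: conj_other_Z)
  qed
qed

text \<open>By the pivot property, scalar products with the left pair are Kronecker deltas in both
  labels, and the right sector is disjoint from it. So just the targeted pair is exchanged, and
  every phase is 1.\<close>

lemma logical_pauli_conj:
  assumes "P \<in> LX ` logical_qubits Q \<union> LZ ` logical_qubits Q"
  shows "circuit_op (code_length Q) circuit * logical_op Q P *
      mat_adjoint (circuit_op (code_length Q) circuit) =
    logical_op Q (logical_hadamard (Left i h) P)"
proof -
  consider (LX_Left) i' h' where "P = LX (Left i' h')" "i' \<in> pivots (slt_a Q)" "h' \<in> pivots (slt_b Q)"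
    | (LZ_Left) i' h' where "P = LZ (Left i' h')" "i' \<in> pivots (slt_a Q)" "h' \<in> pivots (slt_b Q)"
    | (LX_Right) j l where "P = LX (Right j l)" "j \<in> pivots (slt_\<alpha> Q)" "l \<in> pivots (slt_\<beta> Q)"
    | (LZ_Right) j l where "P = LZ (Right j l)" "j \<in> pivots (slt_\<alpha> Q)" "l \<in> pivots (slt_\<beta> Q)"
    using assms unfolding logical_qubits_def by blast
  then show ?thesis
  proof cases
    case LX_Left
    note carr = tensor_carrier(1)[OF LX_Left(3), of "na Q" i'] tensor_carrier(2)[OF i, of "nb Q" h]
    have "left_vec Q (unit_vec (na Q) i' \<otimes>\<^sub>v b h') \<bullet> Z_vec = of_bool (i = i') * of_bool (h' = h)"
      using LX_Left pivot_less h i a_carrier[OF i] b_carrier[OF LX_Left(3)]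
      by (simp add: scalar_prod_left_left_vec[OF carr] scalar_prod_vec_tensor[of _ "na Q" _ _ "nb Q"]
          a_pivot b_pivot)
    then show ?thesis
      using LX_Left left_vec_carrier[OF carr(1)]
      by (cases "i' = i \<and> h' = h") (auto simp: logical_hadamard_def conj_X conj_other_X)
  next
    case LZ_Left
    note carr = tensor_carrier(1)[OF h, of "na Q" i] tensor_carrier(2)[OF LZ_Left(2), of "nb Q" h']
    have "X_vec \<bullet> left_vec Q (a i' \<otimes>\<^sub>v unit_vec (nb Q) h') = of_bool (i' = i) * of_bool (h = h')"
      using LZ_Left pivot_less h i a_carrier[OF LZ_Left(2)] b_carrier[OF h]
      by (simp add: scalar_prod_left_left_vec[OF carr] scalar_prod_vec_tensor[of _ "na Q" _ _ "nb Q"]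
          a_pivot b_pivot)
    then show ?thesis
      using LZ_Left left_vec_carrier[OF carr(2)]
      by (cases "i' = i \<and> h' = h") (auto simp: logical_hadamard_def conj_Z conj_other_Z)
  next
    case LX_Right
    then have "slt_vec (slt_\<alpha> Q) j \<otimes>\<^sub>v unit_vec (mb Q) l \<in> carrier_vec (ma Q * mb Q)"
      by (intro vec_tensor_carrier \<alpha>_carrier unit_vec_carrier)
    then show ?thesis
      using LX_Right right_vec_carrier scalar_prod_right_left_vec[OF _ tensor_carrier(2)[OF i]]
      by (simp add: logical_hadamard_def conj_other_X)
  next
    case LZ_Right
    let ?w = "unit_vec (ma Q) j \<otimes>\<^sub>v slt_vec (slt_\<beta> Q) l"
    have w: "?w \<in> carrier_vec (ma Q * mb Q)"
      using LZ_Right by (intro vec_tensor_carrier \<beta>_carrier unit_vec_carrier)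
    have "X_vec \<bullet> right_vec Q ?w = 0"
      using scalar_prod_right_left_vec[OF w tensor_carrier(1)[OF h]]
        comm_scalar_prod[OF x right_vec_carrier[OF w]] by simp
    then show ?thesis
      using LZ_Right right_vec_carrier[OF w] by (simp add: logical_hadamard_def conj_other_Z)
  qed
qed

lemma implements_hadamard: "implements Q circuit (logical_hadamard (Left i h))"
proof -
  have "1 \<cdot>\<^sub>m A = A" for A :: "complex mat"
    by (rule eq_matI) auto
  then show ?thesis
    unfolding implements_def Let_def using stabilizer_fixed logical_pauli_conj
    by (intro conjI ballI exI[of _ 1]) simp_all
qed

end

section \<open>The circuit family and its uniform asymptotics\<close>

definition left_hadamard_circuit :: "hgp \<Rightarrow> nat \<Rightarrow> nat \<Rightarrow> gate list" where
  "left_hadamard_circuit Q i h =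
    (let q = i * nb Q + h in hadamard_circuit q
       (other_ones (left_vec Q (unit_vec (na Q) i \<otimes>\<^sub>v slt_vec (slt_b Q) h)) q)
       (other_ones (left_vec Q (slt_vec (slt_a Q) i \<otimes>\<^sub>v unit_vec (nb Q) h)) q))"

text \<open>The circuit is a total function of code and labels, so it can witness the family for all
  codes at once. All sizes are expressed by the weights of the two SLT vectors.\<close>

lemma left_hadamard_circuit:
  fixes Q i h
  defines "C \<equiv> left_hadamard_circuit Q i h"
    and "wa \<equiv> hamming_weight (slt_vec (slt_a Q) i)" and "wb \<equiv> hamming_weight (slt_vec (slt_b Q) h)"
  assumes "has_slt_bases Q" "i \<in> pivots (slt_a Q)" "h \<in> pivots (slt_b Q)"
  shows "is_circuit (code_length Q) C" "implements Q C (logical_hadamard (Left i h))"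
    "wb \<le> support_size (code_length Q) C" "support_size (code_length Q) C \<le> wa + wb"
    "wb \<le> circuit_depth C" "circuit_depth C \<le> 2 * (wa + wb)"
proof -
  interpret left_logical_qubit Q i h
    by unfold_locales fact+
  show "is_circuit (code_length Q) C" "implements Q C (logical_hadamard (Left i h))"
    "wb \<le> support_size (code_length Q) C" "support_size (code_length Q) C \<le> wa + wb"
    "wb \<le> circuit_depth C" "circuit_depth C \<le> 2 * (wa + wb)"
    using is_circuit implements_hadamard support_bounds depth_bounds
    unfolding C_def left_hadamard_circuit_def Let_def wa_def wb_def weights by (simp_all add: add.commute)
qed

theorem theorem4p6:
  fixes Q :: "nat \<Rightarrow> hgp" and n :: "nat \<Rightarrow> nat"
  defines "n \<equiv> \<lambda>k. code_length (Q k)"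
  assumes slt: "\<And>k. has_slt_bases (Q k)"
    and n_infinity: "filterlim n at_top sequentially"
    and lengths:
      "(\<lambda>k. real (na (Q k))) \<in> \<Theta>(\<lambda>k. sqrt (real (n k)))"
      "(\<lambda>k. real (nb (Q k))) \<in> \<Theta>(\<lambda>k. sqrt (real (n k)))"
    and dimensions:
      "(\<lambda>k. real (kernel_dim (Ha (Q k)))) \<in> \<Theta>(\<lambda>k. real (na (Q k)))"
      "(\<lambda>k. real (kernel_dim (Hb (Q k)))) \<in> \<Theta>(\<lambda>k. real (nb (Q k)))"
    and distances:
      "(\<lambda>k. real (code_distance (Ha (Q k)))) \<in> \<Theta>(\<lambda>k. real (na (Q k)))"
      "(\<lambda>k. real (code_distance (Hb (Q k)))) \<in> \<Theta>(\<lambda>k. real (nb (Q k)))"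
    and weights:
      "slt_weights_bigtheta (\<lambda>k. slt_a (Q k)) (\<lambda>k. sqrt (real (n k)))"
      "slt_weights_bigtheta (\<lambda>k. slt_\<alpha> (Q k)) (\<lambda>k. sqrt (real (n k)))"
      "slt_weights_bigtheta (\<lambda>k. slt_b (Q k)) (\<lambda>k. sqrt (real (n k)))"
      "slt_weights_bigtheta (\<lambda>k. slt_\<beta> (Q k)) (\<lambda>k. sqrt (real (n k)))"
  shows "\<exists>C :: nat \<Rightarrow> nat \<times> nat \<Rightarrow> gate list.
      (\<forall>k. \<forall>i\<in>pivots (slt_a (Q k)). \<forall>h\<in>pivots (slt_b (Q k)).
         is_circuit (n k) (C k (i, h)) \<and>
         implements (Q k) (C k (i, h)) (logical_hadamard (Left i h))) \<and>
      uniform_bigtheta (\<lambda>k. pivots (slt_a (Q k)) \<times> pivots (slt_b (Q k)))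
        (\<lambda>k q. real (support_size (n k) (C k q))) (\<lambda>k. sqrt (real (n k))) \<and>
      uniform_bigtheta (\<lambda>k. pivots (slt_a (Q k)) \<times> pivots (slt_b (Q k)))
        (\<lambda>k q. real (circuit_depth (C k q))) (\<lambda>k. sqrt (real (n k)))"
proof -
  let ?C = "\<lambda>k (i, h). left_hadamard_circuit (Q k) i h"
  let ?I = "\<lambda>k. pivots (slt_a (Q k)) \<times> pivots (slt_b (Q k))"
  let ?g = "\<lambda>k. sqrt (real (n k))"
  let ?wa = "\<lambda>k i. real (hamming_weight (slt_vec (slt_a (Q k)) i))"
  let ?wb = "\<lambda>k h. real (hamming_weight (slt_vec (slt_b (Q k)) h))"
  obtain c1 c2 where c: "c1 > 0" "c2 > 0" and wa: "\<forall>\<^sub>F k in sequentially.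
      \<forall>i\<in>pivots (slt_a (Q k)). c1 * ?g k \<le> ?wa k i \<and> ?wa k i \<le> c2 * ?g k"
    using weights(1) unfolding slt_weights_bigtheta_def uniform_bigtheta_def by blast
  obtain d1 d2 where d: "d1 > 0" "d2 > 0" and wb: "\<forall>\<^sub>F k in sequentially.
      \<forall>h\<in>pivots (slt_b (Q k)). d1 * ?g k \<le> ?wb k h \<and> ?wb k h \<le> d2 * ?g k"
    using weights(3) unfolding slt_weights_bigtheta_def uniform_bigtheta_def by blast
  \<comment> \<open>One sandwich covers support and depth: the lower constant is that of the
    \<open>slt_b\<close> weights, the upper one twice the sum of both upper constants. None depends
    on the labels.\<close>
  have theta: "uniform_bigtheta ?I f ?g"
    if f: "\<And>k i h. i \<in> pivots (slt_a (Q k)) \<Longrightarrow> h \<in> pivots (slt_b (Q k)) \<Longrightarrow>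
      ?wb k h \<le> f k (i, h) \<and> f k (i, h) \<le> 2 * (?wa k i + ?wb k h)" for f
    unfolding uniform_bigtheta_def
  proof (intro exI conjI)
    show "\<forall>\<^sub>F k in sequentially. \<forall>q\<in>?I k. d1 * ?g k \<le> f k q \<and> f k q \<le> (2 * (c2 + d2)) * ?g k"
      using wa wb
    proof eventually_elim
      case (elim k)
      show ?case
      proof clarify
        fix i h assume ih: "i \<in> pivots (slt_a (Q k))" "h \<in> pivots (slt_b (Q k))"
        have "?wa k i \<le> c2 * ?g k" "d1 * ?g k \<le> ?wb k h" "?wb k h \<le> d2 * ?g k"
          using elim ih by auto
        with f[OF ih] show "d1 * ?g k \<le> f k (i, h) \<and> f k (i, h) \<le> (2 * (c2 + d2)) * ?g k"
          by (simp add: algebra_simps)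
      qed
    qed
  qed (use c d in auto)
  note C = left_hadamard_circuit[OF slt]
  have support: "uniform_bigtheta ?I (\<lambda>k q. real (support_size (n k) (?C k q))) ?g"
  proof (rule theta)
    fix k i h assume "i \<in> pivots (slt_a (Q k))" "h \<in> pivots (slt_b (Q k))"
    from C(3,4)[OF this] show "?wb k h \<le> real (support_size (n k) (?C k (i, h))) \<and>
        real (support_size (n k) (?C k (i, h))) \<le> 2 * (?wa k i + ?wb k h)"
      by (simp add: n_def)
  qed
  have depth: "uniform_bigtheta ?I (\<lambda>k q. real (circuit_depth (?C k q))) ?g"
  proof (rule theta)
    fix k i h assume "i \<in> pivots (slt_a (Q k))" "h \<in> pivots (slt_b (Q k))"
    from C(5,6)[OF this] show "?wb k h \<le> real (circuit_depth (?C k (i, h))) \<and>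
        real (circuit_depth (?C k (i, h))) \<le> 2 * (?wa k i + ?wb k h)"
      by simp
  qed
  have "is_circuit (n k) (?C k (i, h)) \<and> implements (Q k) (?C k (i, h)) (logical_hadamard (Left i h))"
    if "i \<in> pivots (slt_a (Q k))" "h \<in> pivots (slt_b (Q k))" for k i h
    using C(1,2)[OF that] by (simp add: n_def)
  then show ?thesis
    using support depth by (intro exI[of _ ?C]) blast
qed

end
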